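(* Let $D$ be an oriented path with $\mathcal{C}(P_3,D)=\mathcal{C}(P_5,D)=0$ and $\mathcal{C}(2P_3,D)\ne0$. Let $\ell$ be the minimum positive integer such that $\mathcal{C}(P_{2\ell+1},D)\ne0$, if it exists. (i) If $\mathcal{C}(2P_3,D)>0$ and either $\ell$ does not exist or $(-1)^\ell\mathcal{C}(P_{2\ell+1},D)>0$, then $D$ is locally tournament Sidorenko (LTS). (ii) If $\mathcal{C}(2P_3,D)<0$ and either $\ell$ does not exist or $(-1)^\ell\mathcal{C}(P_{2\ell+1},D)<0$, then $D$ is locally tournament anti-Sidorenko (LTAS). (iii) Otherwise, i.e. if $\ell$ exists and $\mathcal{C}(2P_3,D)\,(-1)^\ell\,\mathcal{C}(P_{2\ell+1},D)<0$, then $D$ is neither LTS nor LTAS.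
   Context: A weighted tournament on $n$ vertices is a function $A:[n]^2\to[0,1]$ with $A(x,y)+A(y,x)=1$ for all $x,y$ (so $A(x,x)=1/2$). For a digraph $D$, $t_D(A)=n^{-v(D)}\sum_{\phi:V(D)\to[n]}\prod_{(x,y)\in E(D)}A(\phi(x),\phi(y))$. Write $A=\frac12J+B$ with $J$ the all-ones matrix and $B$ skew-symmetric, and let $\lambda_{\max}(B)$ be the largest modulus of an eigenvalue of $B$. $D$ is LTS if there is $\varepsilon=\varepsilon(D)>0$ such that for every $n$ and every weighted tournament $A=\frac12J+B$ on $n$ vertices with $\lambda_{\max}(B)\le\varepsilon n$ one has $t_D(A)\ge2^{-e(D)}$; it is LTAS if there is such an $\varepsilon$ with $t_D(A)\le2^{-e(D)}$ for all such $A$. An oriented path is an orientation of a finite path. $P_m$ is the directed path on $m$ vertices with all edges oriented left to right; $2P_3$ is the vertex-disjoint union of two copies of $P_3$. For $G=P_{2k+1}$ ($k\ge1$) or $G=2P_3$, the signed count $\mathcal{C}(G,D)$ is the sum of $(-1)^{r(D')}$ over all (not necessarily induced) subgraphs $D'$ of $D$ without isolated vertices whose underlying undirected graph is isomorphic to that of $G$, where $r(D')$ is the number of edges of $G$ whose direction is reversed under an isomorphism from the underlying graph of $G$ to that of $D'$ (its parity is independent of the isomorphism because each component has an even number of edges). *)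

theory Defs
  imports
    "HOL-Library.FuncSet"
    "Graph_Theory.Digraph_Component"
    "Jordan_Normal_Form.Spectral_Radius"
begin

section \<open>Weighted tournaments\<close>

text \<open>The vertex set of a weighted tournament on \<open>n\<close> vertices is \<open>{0..<n}\<close>.\<close>

definition weighted_tournament :: "nat \<Rightarrow> real mat \<Rightarrow> bool" where
  "weighted_tournament n A \<longleftrightarrow>
     A \<in> carrier_mat n n \<and>
     (\<forall>x<n. \<forall>y<n. 0 \<le> A $$ (x, y) \<and> A $$ (x, y) \<le> 1 \<and> A $$ (x, y) + A $$ (y, x) = 1)"

definition all_ones_mat :: "nat \<Rightarrow> real mat" where
  "all_ones_mat n = mat n n (\<lambda>_. 1)"

definition skew_part :: "real mat \<Rightarrow> real mat" where
  "skew_part A = A - (1 / 2) \<cdot>\<^sub>m all_ones_mat (dim_row A)"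

text \<open>A real skew-symmetric matrix has purely imaginary eigenvalues, so eigenvalues are
  taken over the complex numbers.\<close>

definition lambda_max :: "real mat \<Rightarrow> real" where
  "lambda_max B = spectral_radius (map_mat complex_of_real B)"

definition hom_density :: "'a pair_pre_digraph \<Rightarrow> real mat \<Rightarrow> real" where
  "hom_density D A =
     (\<Sum>\<phi> \<in> pverts D \<rightarrow>\<^sub>E {..<dim_row A}. \<Prod>(x, y) \<in> parcs D. A $$ (\<phi> x, \<phi> y))
       / real (dim_row A) ^ card (pverts D)"

text \<open>The number of vertices is taken to be positive: for \<open>n = 0\<close> neither the density nor the
  largest eigenvalue modulus makes sense.\<close>

definition LTS :: "'a pair_pre_digraph \<Rightarrow> bool" where
  "LTS D \<longleftrightarrow>
     (\<exists>\<epsilon>>0. \<forall>n\<ge>1. \<forall>A. weighted_tournament n A \<and> lambda_max (skew_part A) \<le> \<epsilon> * real n \<longrightarrow>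
        hom_density D A \<ge> 1 / 2 ^ card (parcs D))"

definition LTAS :: "'a pair_pre_digraph \<Rightarrow> bool" where
  "LTAS D \<longleftrightarrow>
     (\<exists>\<epsilon>>0. \<forall>n\<ge>1. \<forall>A. weighted_tournament n A \<and> lambda_max (skew_part A) \<le> \<epsilon> * real n \<longrightarrow>
        hom_density D A \<le> 1 / 2 ^ card (parcs D))"


section \<open>Oriented paths and signed counts\<close>

definition directed_path :: "nat \<Rightarrow> nat pair_pre_digraph" where
  "directed_path m = \<lparr> pverts = {..<m}, parcs = {(i, Suc i) | i. Suc i < m} \<rparr>"

definition disjoint_union ::
    "'a pair_pre_digraph \<Rightarrow> 'b pair_pre_digraph \<Rightarrow> ('a + 'b) pair_pre_digraph" where
  "disjoint_union G H =
     \<lparr> pverts = pverts G <+> pverts H,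
       parcs = {(Inl u, Inl v) | u v. (u, v) \<in> parcs G} \<union> {(Inr u, Inr v) | u v. (u, v) \<in> parcs H} \<rparr>"

definition two_P3 :: "(nat + nat) pair_pre_digraph" where
  "two_P3 = disjoint_union (directed_path 3) (directed_path 3)"

text \<open>The underlying undirected graph of a digraph is represented by its symmetric closure
  \<^const>\<open>mk_symmetric\<close>.\<close>

definition underlying_iso ::
    "('a \<Rightarrow> 'b) \<Rightarrow> 'a pair_pre_digraph \<Rightarrow> 'b pair_pre_digraph \<Rightarrow> bool" where
  "underlying_iso f G H \<longleftrightarrow>
     bij_betw f (pverts G) (pverts H) \<and>
     (\<forall>u \<in> pverts G. \<forall>v \<in> pverts G.
        (u, v) \<in> parcs (mk_symmetric (with_proj G)) \<longleftrightarrow> (f u, f v) \<in> parcs (mk_symmetric (with_proj H)))"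

text \<open>An orientation of a finite path: the underlying graph is a path on \<open>m \<ge> 1\<close> vertices, and
  \<^term>\<open>asym (parcs D)\<close> says that each edge receives exactly one direction.\<close>

definition oriented_path :: "'a pair_pre_digraph \<Rightarrow> bool" where
  "oriented_path D \<longleftrightarrow>
     pair_fin_digraph D \<and> asym (parcs D) \<and>
     (\<exists>m\<ge>1. \<exists>f. underlying_iso f (directed_path m) D)"

definition no_isolated_vertices :: "'a pair_pre_digraph \<Rightarrow> bool" where
  "no_isolated_vertices H \<longleftrightarrow> (\<forall>v \<in> pverts H. \<exists>u. (u, v) \<in> parcs (mk_symmetric (with_proj H)))"

definition copies :: "'b pair_pre_digraph \<Rightarrow> 'a pair_pre_digraph \<Rightarrow> 'a pair_pre_digraph set" where
  "copies G D =
     {H. subgraph (with_proj H) (with_proj D) \<and> no_isolated_vertices H \<and> (\<exists>f. underlying_iso f G H)}"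

definition reversed_edges ::
    "('b \<Rightarrow> 'a) \<Rightarrow> 'b pair_pre_digraph \<Rightarrow> 'a pair_pre_digraph \<Rightarrow> nat" where
  "reversed_edges f G H = card {(u, v). (u, v) \<in> parcs G \<and> (f v, f u) \<in> parcs H}"

text \<open>The isomorphism is an arbitrary choice; when every component of \<open>G\<close> is a path with an even
  number of edges, the parity of the number of reversed edges does not depend on it.\<close>

definition signed_count :: "'b pair_pre_digraph \<Rightarrow> 'a pair_pre_digraph \<Rightarrow> int" where
  "signed_count G D =
     (\<Sum>H \<in> copies G D. (- 1) ^ reversed_edges (SOME f. underlying_iso f G H) G H)"

definition ell_exists :: "'a pair_pre_digraph \<Rightarrow> bool" where
  "ell_exists D \<longleftrightarrow> (\<exists>l\<ge>1. signed_count (directed_path (2 * l + 1)) D \<noteq> 0)"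

text \<open>Only meaningful under \<^const>\<open>ell_exists\<close>.\<close>

definition ell :: "'a pair_pre_digraph \<Rightarrow> nat" where
  "ell D = (LEAST l. l \<ge> 1 \<and> signed_count (directed_path (2 * l + 1)) D \<noteq> 0)"

end

theory Submission
  imports Defs "HOL-Analysis.Convex"
begin

text \<open>
  Expand \<open>2\<^sup>e t(D, A)\<close>, for \<open>A = J/2 + B\<close> and \<open>e\<close> the number of edges of \<open>D\<close>, over the edge subsets of \<open>D\<close>.
  A subset contributes, up to sign, \<open>2\<close> to its cardinality times the product over its maximal runs of edges
  of the means \<open>y(j)\<close> of the row vector \<open>1 (B/n)^j\<close>, where \<open>j\<close> is the length of the run. As \<open>B\<close> is
  skew-symmetric, \<open>y(j) = 0\<close> for odd \<open>j\<close> and \<open>y(2k) = (-1)^k x(k)\<close>, where \<open>x(k)\<close> is the mean square of \<open>1 (B/n)^k\<close>.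
  If the spectral radius of \<open>B\<close> is at most \<open>\<epsilon> n\<close>, then \<open>x(k+1) \<le> \<eta> x(k)\<close> with \<open>\<eta> = (2\<epsilon>)^2\<close>, so apart from
  \<open>1\<close> only the terms \<open>16 C(2P3, D) x(1)^2\<close> and \<open>(-4)^l C(P(2l+1), D) x(l)\<close> matter, up to relative error
  \<open>O(\<eta>)\<close>. If their signs agree, this decides the sign of \<open>2\<^sup>e t(D, A) - 1\<close>. Otherwise \<open>l \<ge> 3\<close>, and
  for rank-two kernels on four vertices, whose \<open>x\<close> is the moment sequence of a small mass at one small
  point (plus a mass at 0), either term can be made to dominate.
\<close>


section \<open>Walk means\<close>

text \<open>The tolerance \<epsilon> may depend on D but not on the number of vertices, so every
  error has to be a small multiple of a leading term, with constants that depend on D alone. Bounds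
  on the powers of B/n that come from the spectral radius carry constants that depend on B. They
  serve only to show that x(k) / (2 \<epsilon>)^(2k) is bounded: by Cauchy-Schwarz this sequence is
  log-convex, and a bounded log-convex sequence decreases, which leaves no constant behind. The two
  leading terms can be played off against each other because x(1)^2 is quadratic in the mass and
  x(l) is linear. For a mass m at the point s they are m^2 s^2 and m s^l. Letting m tend to 0 with s
  fixed favours x(l); fixing m and letting s tend to 0 favours x(1)^2 exactly when l is at least 3,
  which is what the vanishing of C(P3, D) and C(P5, D) provides.\<close>

definition avg :: "nat \<Rightarrow> (nat \<Rightarrow> real) \<Rightarrow> real" where
  "avg n f = (\<Sum>x<n. f x) / real n"

lemma avg_const [simp]: "n > 0 \<Longrightarrow> avg n (\<lambda>_. c) = c"
  by (simp add: avg_def)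

lemma avg_cmult: "avg n (\<lambda>x. c * f x) = c * avg n f"
  by (simp add: avg_def sum_distrib_left)

text \<open>The kernel may change from step to step, so that an edge outside a chosen subset can be
  given the constant kernel 1.\<close>

primrec walk :: "nat \<Rightarrow> (nat \<Rightarrow> nat \<Rightarrow> nat \<Rightarrow> real) \<Rightarrow> nat \<Rightarrow> nat \<Rightarrow> real" where
  "walk n g 0 y = 1"
| "walk n g (Suc e) y = avg n (\<lambda>x. walk n g e x * g e x y)"

text \<open>The factor \<open>h\<close> at the last vertex makes the induction work: fixing the
  value y of the last vertex leaves the shorter sum, with x \<mapsto> \<open>g e x y * h y\<close>
  in the place of \<open>h\<close>.\<close>

lemma sum_PiE_walk:
  assumes "n > 0"
  shows "(\<Sum>\<psi> \<in> {..<Suc e} \<rightarrow>\<^sub>E {..<n}. (\<Prod>i<e. g i (\<psi> i) (\<psi> (Suc i))) * h (\<psi> e)) =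
    real n ^ Suc e * avg n (\<lambda>x. walk n g e x * h x)"
proof (induction e arbitrary: h)
  case 0
  have eq: "{..<Suc 0} \<rightarrow>\<^sub>E {..<n} = (\<lambda>x. (\<lambda>_. undefined)(0 := x)) ` {..<n}"
    by (subst lessThan_Suc, subst PiE_insert_eq) (auto simp: image_iff)
  have "inj_on (\<lambda>x. (\<lambda>_::nat. undefined)(0 := x)) {..<n}"
    by (rule inj_onI) (metis fun_upd_same)
  then show ?case using assms unfolding eq
    by (simp add: sum.reindex avg_def)
next
  case (Suc e)
  let ?P = "{..<Suc e} \<rightarrow>\<^sub>E {..<n}"
  have eq: "{..<Suc (Suc e)} \<rightarrow>\<^sub>E {..<n} = (\<lambda>(y, \<psi>). \<psi>(Suc e := y)) ` ({..<n} \<times> ?P)"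
    by (subst lessThan_Suc, subst PiE_insert_eq, simp)
  have inj: "inj_on (\<lambda>(y, \<psi>). \<psi>(Suc e := y)) ({..<n} \<times> ?P)"
    using inj_combinator[of "Suc e" "{..<Suc e}" "\<lambda>_. {..<n}"] by simp
  have "(\<Sum>\<psi> \<in> {..<Suc (Suc e)} \<rightarrow>\<^sub>E {..<n}.
          (\<Prod>i<Suc e. g i (\<psi> i) (\<psi> (Suc i))) * h (\<psi> (Suc e))) =
        (\<Sum>(y, \<psi>) \<in> {..<n} \<times> ?P. (\<Prod>i<e. g i (\<psi> i) (\<psi> (Suc i))) * (g e (\<psi> e) y * h y))"
    unfolding eq sum.reindex[OF inj]
  proof (rule sum.cong[OF refl], clarify)
    fix y \<psi>
    have "(\<Prod>i<e. g i ((\<psi>(Suc e := y)) i) ((\<psi>(Suc e := y)) (Suc i))) = (\<Prod>i<e. g i (\<psi> i) (\<psi> (Suc i)))"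
      by (rule prod.cong) auto
    then show "((\<lambda>\<psi>. (\<Prod>i<Suc e. g i (\<psi> i) (\<psi> (Suc i))) * h (\<psi> (Suc e))) \<circ> (\<lambda>(y, \<psi>). \<psi>(Suc e := y))) (y, \<psi>) =
        (\<Prod>i<e. g i (\<psi> i) (\<psi> (Suc i))) * (g e (\<psi> e) y * h y)"
      by (simp add: mult.assoc)
  qed
  also have "\<dots> = (\<Sum>y<n. \<Sum>\<psi>\<in>?P. (\<Prod>i<e. g i (\<psi> i) (\<psi> (Suc i))) * (g e (\<psi> e) y * h y))"
    by (simp add: sum.cartesian_product)
  also have "\<dots> = (\<Sum>y<n. real n ^ Suc e * avg n (\<lambda>x. walk n g e x * (g e x y * h y)))"
  proof (rule sum.cong[OF refl])
    fix y
    show "(\<Sum>\<psi>\<in>?P. (\<Prod>i<e. g i (\<psi> i) (\<psi> (Suc i))) * (g e (\<psi> e) y * h y)) =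
      real n ^ Suc e * avg n (\<lambda>x. walk n g e x * (g e x y * h y))"
      by (rule Suc.IH[where h = "\<lambda>x. g e x y * h y"])
  qed
  also have "\<dots> = (\<Sum>y<n. real n ^ Suc e * (h y * walk n g (Suc e) y))"
    by (simp add: avg_cmult[symmetric] mult_ac)
  also have "\<dots> = real n ^ Suc (Suc e) * avg n (\<lambda>x. walk n g (Suc e) x * h x)"
    using assms unfolding sum_distrib_left[symmetric] avg_def[of n "\<lambda>x. walk n g (Suc e) x * h x"]
    by (simp add: mult.commute del: walk.simps)
  finally show ?case .
qed

text \<open>The mean, over all maps of the e + 1 path vertices, of the product of \<open>B\<close>
  along the edges in \<open>S\<close>.\<close>

definition path_mean :: "nat \<Rightarrow> (nat \<Rightarrow> nat \<Rightarrow> real) \<Rightarrow> nat set \<Rightarrow> nat \<Rightarrow> real" where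
  "path_mean n B S e = avg n (walk n (\<lambda>i x y. if i \<in> S then B x y else 1) e)"

text \<open>Every edge outside S contributes 1/2, so the prefactor 2^e leaves 2 to the number of
  edges in S. The sign \<sigma> i records the direction of edge i.\<close>

lemma path_density_expand:
  fixes \<sigma> :: "nat \<Rightarrow> real"
  assumes "n > 0"
  shows "2 ^ e * ((\<Sum>\<psi> \<in> {..<Suc e} \<rightarrow>\<^sub>E {..<n}. \<Prod>i<e. 1 / 2 + \<sigma> i * B (\<psi> i) (\<psi> (Suc i))) / real n ^ Suc e) =
    (\<Sum>S\<in>Pow {..<e}. 2 ^ card S * (\<Prod>i\<in>S. \<sigma> i) * path_mean n B S e)"
proof -
  let ?P = "{..<Suc e} \<rightarrow>\<^sub>E {..<n}"
  have "(\<Sum>\<psi>\<in>?P. \<Prod>i<e. 1 / 2 + \<sigma> i * B (\<psi> i) (\<psi> (Suc i))) =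
        (\<Sum>\<psi>\<in>?P. \<Sum>S\<in>Pow {..<e}. (\<Prod>i\<in>S. \<sigma> i * B (\<psi> i) (\<psi> (Suc i))) * (\<Prod>i\<in>{..<e} - S. 1 / 2))"
    by (subst add.commute, subst prod_add) auto
  also have "\<dots> = (\<Sum>S\<in>Pow {..<e}. (\<Prod>i\<in>S. \<sigma> i) * (1 / 2) ^ (e - card S) *
       (\<Sum>\<psi>\<in>?P. \<Prod>i\<in>S. B (\<psi> i) (\<psi> (Suc i))))"
    by (subst sum.swap, rule sum.cong[OF refl])
       (auto simp: sum_distrib_left prod.distrib card_Diff_subset finite_subset mult_ac intro!: sum.cong)
  also have "\<dots> = (\<Sum>S\<in>Pow {..<e}. (\<Prod>i\<in>S. \<sigma> i) * (1 / 2) ^ (e - card S) *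
       (real n ^ Suc e * path_mean n B S e))"
  proof (rule sum.cong[OF refl])
    fix S assume S: "S \<in> Pow {..<e}"
    have "(\<Sum>\<psi>\<in>?P. \<Prod>i\<in>S. B (\<psi> i) (\<psi> (Suc i))) =
      (\<Sum>\<psi>\<in>?P. (\<Prod>i<e. if i \<in> S then B (\<psi> i) (\<psi> (Suc i)) else 1) * 1)"
      using S by (intro sum.cong refl) (auto simp: prod.If_cases Int_absorb1)
    also have "\<dots> = real n ^ Suc e * path_mean n B S e"
      using sum_PiE_walk[OF assms, where h = "\<lambda>_. 1" and g = "\<lambda>i x y. if i \<in> S then B x y else 1" and e = e]
      by (simp add: path_mean_def)
    finally show "(\<Prod>i\<in>S. \<sigma> i) * (1 / 2) ^ (e - card S) * (\<Sum>\<psi>\<in>?P. \<Prod>i\<in>S. B (\<psi> i) (\<psi> (Suc i))) =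
      (\<Prod>i\<in>S. \<sigma> i) * (1 / 2) ^ (e - card S) * (real n ^ Suc e * path_mean n B S e)" by simp
  qed
  finally have *: "(\<Sum>\<psi>\<in>?P. \<Prod>i<e. 1 / 2 + \<sigma> i * B (\<psi> i) (\<psi> (Suc i))) = \<dots>" .
  show ?thesis unfolding * sum_divide_distrib sum_distrib_left
  proof (rule sum.cong[OF refl])
    fix S assume "S \<in> Pow {..<e}"
    then have "card S \<le> e" using card_mono[of "{..<e}" S] by auto
    then have "(2::real) ^ e * (1 / 2) ^ (e - card S) = 2 ^ card S"
      by (simp add: power_diff power_one_over)
    then show "2 ^ e * ((\<Prod>i\<in>S. \<sigma> i) * (1 / 2) ^ (e - card S) * (real n ^ Suc e * path_mean n B S e) / real n ^ Suc e)
      = 2 ^ card S * (\<Prod>i\<in>S. \<sigma> i) * path_mean n B S e"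
      using assms by (simp add: field_simps del: power_Suc)
  qed
qed

abbreviation pw :: "nat \<Rightarrow> (nat \<Rightarrow> nat \<Rightarrow> real) \<Rightarrow> nat \<Rightarrow> nat \<Rightarrow> real" where
  "pw n B \<equiv> walk n (\<lambda>_. B)"

text \<open>Edge a + j is missing, so the kernel there is 1 and the walk vector becomes constant,
  equal to the mean of the first run. All later steps are linear in that constant.\<close>

lemma path_mean_split:
  assumes n: "n > 0" and S: "S = {a..<a + j} \<union> S'" and S': "S' \<subseteq> {Suc (a + j)..}" and e: "a + j \<le> e"
  shows "path_mean n B S e = avg n (pw n B j) * path_mean n B S' e"
proof -
  let ?W = "\<lambda>S. walk n (\<lambda>i x y. if i \<in> S then B x y else 1)"
  have one: "?W T i = (\<lambda>_. 1)" if "T \<inter> {..<i} = {}" for T i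
    using that
  proof (induction i)
    case (Suc i)
    then have "i \<notin> T" "T \<inter> {..<i} = {}" by (auto simp: lessThan_Suc)
    with Suc.IH n show ?case by (auto simp: fun_eq_iff)
  qed auto
  have run: "i \<le> j \<Longrightarrow> ?W S (a + i) = pw n B i" for i
  proof (induction i)
    case 0
    have "S \<inter> {..<a} = {}" using S S' by auto
    then show ?case using one by (auto simp: fun_eq_iff)
  next
    case (Suc i)
    then have "a + i \<in> S" using S by auto
    with Suc show ?case by (auto simp: fun_eq_iff)
  qed
  have tail: "?W S (Suc (a + j) + i) = (\<lambda>y. avg n (pw n B j) * ?W S' (Suc (a + j) + i) y)" for i
  proof (induction i)
    case 0
    have "a + j \<notin> S" "S' \<inter> {..<Suc (a + j)} = {}" using S S' by auto
    with run[of j] one show ?case by (simp add: fun_eq_iff del: walk.simps(2)) simp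
  next
    case (Suc i)
    have "Suc (a + j) + i \<in> S \<longleftrightarrow> Suc (a + j) + i \<in> S'" using S by auto
    moreover have "Suc (a + j) + Suc i = Suc (Suc (a + j) + i)" by simp
    ultimately show ?case
      by (simp only: walk.simps(2) Suc.IH avg_cmult mult.assoc)
  qed
  show ?thesis
  proof (cases "e = a + j")
    case True
    \<comment> \<open>The run ends at the last vertex, and no edge of S' lies before it, so the
      second factor is 1.\<close>
    have "S' \<inter> {..<a + j} = {}" using S' by auto
    then show ?thesis using n run[of j] one by (simp add: path_mean_def True)
  next
    case False
    with e obtain i where "e = Suc (a + j) + i" by (metis le_Suc_ex le_neq_implies_less Suc_leI)
    then show ?thesis using tail by (simp add: path_mean_def avg_cmult del: walk.simps)
  qed
qed

lemma path_mean_empty: "n > 0 \<Longrightarrow> path_mean n B {} e = 1"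
proof -
  assume n: "n > 0"
  have "walk n (\<lambda>i x y. if i \<in> {} then B x y else 1) e = (\<lambda>_. 1)"
    using n by (induction e) (auto simp: fun_eq_iff)
  then show ?thesis using n by (simp add: path_mean_def)
qed

section \<open>Decomposition of an edge subset into runs, and the size of its contribution\<close>

lemma first_run:
  fixes S :: "nat set"
  assumes "finite S" "S \<noteq> {}"
  obtains a j S' where "j \<ge> 1" "S = {a..<a + j} \<union> S'" "S' \<subseteq> {Suc (a + j)..}"
proof -
  define a where "a = Min S"
  define b where "b = (LEAST i. i \<ge> a \<and> i \<notin> S)"
  have a: "a \<in> S" "\<And>x. x \<in> S \<Longrightarrow> a \<le> x" using assms by (auto simp: a_def)
  have ex: "\<exists>i. i \<ge> a \<and> i \<notin> S"
    using assms(1) by (meson finite_nat_set_iff_bounded_le linear not_less_eq_eq)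
  have b: "b \<ge> a" "b \<notin> S" using LeastI_ex[OF ex] by (auto simp: b_def)
  have less: "i \<in> S" if "a \<le> i" "i < b" for i
    using not_less_Least[of i "\<lambda>i. i \<ge> a \<and> i \<notin> S"] that unfolding b_def by auto
  have "b \<noteq> a" using a b by auto
  then have "b - a \<ge> 1" "a + (b - a) = b" using b by auto
  moreover have "S = {a..<b} \<union> {x \<in> S. b < x}"
    using a b less by (auto simp: not_le) (metis linorder_neqE_nat)
  moreover have "{x \<in> S. b < x} \<subseteq> {Suc b..}" by auto
  ultimately show ?thesis using that[of "b - a" a "{x \<in> S. b < x}"] by simp
qed

text \<open>The interface between the analysis of B and the counting of edge subsets. The spectral
  bound enters only through \<eta>, which becomes (2 \<epsilon>)^2.\<close>

locale moments =
  fixes n :: nat and B :: "nat \<Rightarrow> nat \<Rightarrow> real" and x :: "nat \<Rightarrow> real" and \<eta> :: real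
  assumes n: "n > 0"
    and odd_zero: "odd j \<Longrightarrow> avg n (pw n B j) = 0"
    and even_moment: "avg n (pw n B (2 * k)) = (- 1) ^ k * x k"
    and x_0: "x 0 = 1"
    and x_nonneg: "0 \<le> x k"
    and x_Suc: "x (Suc k) \<le> \<eta> * x k"
    and \<eta>: "0 \<le> \<eta>" "\<eta> \<le> 1"
begin

abbreviation "y j \<equiv> avg n (pw n B j)"

lemma x_add: "x (k + i) \<le> \<eta> ^ i * x k"
proof (induction i)
  case (Suc i)
  have "x (k + Suc i) \<le> \<eta> * x (k + i)" using x_Suc[of "k + i"] by simp
  also have "\<dots> \<le> \<eta> * (\<eta> ^ i * x k)" using Suc \<eta> by (intro mult_left_mono) auto
  finally show ?case by (simp add: mult_ac)
qed simp

lemma x_decr: "i \<le> k \<Longrightarrow> x k \<le> x i"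
proof -
  assume "i \<le> k"
  then have "x k \<le> \<eta> ^ (k - i) * x i" using x_add[of i "k - i"] by simp
  also have "\<dots> \<le> 1 * x i" using \<eta> x_nonneg by (intro mult_right_mono power_le_one) auto
  finally show ?thesis by simp
qed

lemma x_decr_strict: "i < k \<Longrightarrow> x k \<le> \<eta> * x i"
  using x_decr[of "Suc i" k] x_Suc[of i] by linarith

lemma abs_y: "\<bar>y j\<bar> \<le> 1" "j \<ge> 1 \<Longrightarrow> \<bar>y j\<bar> \<le> \<eta>"
proof -
  have *: "\<bar>y (2 * k)\<bar> = x k" for k by (simp add: even_moment abs_mult power_abs x_nonneg)
  show "\<bar>y j\<bar> \<le> 1"
    using odd_zero[of j] *[of "j div 2"] x_decr[of 0 "j div 2"] x_0 by (cases "even j") auto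
  show "\<bar>y j\<bar> \<le> \<eta>" if "j \<ge> 1"
  proof (cases "even j")
    case True
    with that have "0 < j div 2" by auto
    then have "x (j div 2) \<le> \<eta> * x 0" by (rule x_decr_strict)
    with True *[of "j div 2"] x_0 show ?thesis by simp
  qed (use odd_zero[of j] \<eta> in auto)
qed

text \<open>Odd runs vanish and the moments decrease, so two runs contribute at most the square of
  the first moment; a run of length above 2 gains a factor \<eta>.\<close>

lemma abs_y_mult:
  assumes "j \<ge> 1" "j' \<ge> 1"
  shows "\<bar>y j * y j'\<bar> \<le> x 1 ^ 2" "(j, j') \<noteq> (2, 2) \<Longrightarrow> \<bar>y j * y j'\<bar> \<le> \<eta> * x 1 ^ 2"
proof -
  have "\<bar>y j * y j'\<bar> \<le> x 1 ^ 2 \<and> ((j, j') \<noteq> (2, 2) \<longrightarrow> \<bar>y j * y j'\<bar> \<le> \<eta> * x 1 ^ 2)"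
  proof (cases "even j \<and> even j'")
    case False
    then show ?thesis using odd_zero \<eta> by auto
  next
    case True
    then obtain k k' where k: "j = 2 * k" "j' = 2 * k'" by (auto elim!: evenE)
    have k1: "k \<ge> 1" "k' \<ge> 1" using assms k by auto
    have eq: "\<bar>y j * y j'\<bar> = x k * x k'"
      by (simp add: k even_moment abs_mult power_abs x_nonneg)
    have le: "x k \<le> x 1" "x k' \<le> x 1" using k1 x_decr by auto
    have "x k * x k' \<le> x 1 * x 1" using le x_nonneg by (intro mult_mono) auto
    moreover have "x k * x k' \<le> \<eta> * (x 1 * x 1)" if "k \<noteq> 1 \<or> k' \<noteq> 1"
    proof (cases "k = 1")
      case True
      then have "x k' \<le> \<eta> * x 1" using that k1 x_decr_strict[of 1 k'] by auto
      then have "x k * x k' \<le> x 1 * (\<eta> * x 1)" using le x_nonneg by (intro mult_mono) auto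
      then show ?thesis by (simp add: mult_ac)
    next
      case False
      then have "x k \<le> \<eta> * x 1" using that k1 x_decr_strict[of 1 k] by auto
      then have "x k * x k' \<le> (\<eta> * x 1) * x 1" using le x_nonneg \<eta> by (intro mult_mono) auto
      then show ?thesis by (simp add: mult_ac)
    qed
    ultimately show ?thesis unfolding eq using k by (auto simp: power2_eq_square)
  qed
  then show "\<bar>y j * y j'\<bar> \<le> x 1 ^ 2" "(j, j') \<noteq> (2, 2) \<Longrightarrow> \<bar>y j * y j'\<bar> \<le> \<eta> * x 1 ^ 2" by auto
qed

lemma split_first_run:
  assumes "S \<subseteq> {..<e}" "S \<noteq> {}"
  obtains a j S' where "j \<ge> 1" "S = {a..<a + j} \<union> S'" "S' \<subseteq> {Suc (a + j)..}" "a + j \<le> e"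
    "S' \<subset> S" "S' \<subseteq> {..<e}" "path_mean n B S e = y j * path_mean n B S' e"
proof -
  have "finite S" using assms finite_subset by auto
  then obtain a j S' where *: "j \<ge> 1" "S = {a..<a + j} \<union> S'" "S' \<subseteq> {Suc (a + j)..}"
    using first_run assms(2) by metis
  have "a + j - 1 \<in> S" using *(1,2) by auto
  then have e: "a + j \<le> e" using assms(1) *(1) by auto
  have "a \<in> S" "a \<notin> S'" using * by auto
  then have "S' \<subset> S" using * by blast
  moreover have "S' \<subseteq> {..<e}" using * assms by auto
  ultimately show ?thesis using that * e path_mean_split[OF n *(2,3) e] by blast
qed

text \<open>Runs are peeled off one at a time. The first one supplies the factor \<eta>, the others
  are at most 1.\<close>

lemma abs_path_mean:
  assumes "S \<subseteq> {..<e}"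
  shows "\<bar>path_mean n B S e\<bar> \<le> 1" "S \<noteq> {} \<Longrightarrow> \<bar>path_mean n B S e\<bar> \<le> \<eta>"
proof -
  have "finite S" using assms finite_subset by auto
  then have "\<bar>path_mean n B S e\<bar> \<le> 1 \<and> (S \<noteq> {} \<longrightarrow> \<bar>path_mean n B S e\<bar> \<le> \<eta>)" using assms
  proof (induction rule: finite_psubset_induct)
    case (psubset S)
    show ?case
    proof (cases "S = {}")
      case True
      then show ?thesis using n by (simp add: path_mean_empty)
    next
      case False
      then obtain a j S' where *: "j \<ge> 1" "S' \<subset> S" "S' \<subseteq> {..<e}"
        "path_mean n B S e = y j * path_mean n B S' e"
        using split_first_run[OF psubset.prems] by metis
      have "\<bar>path_mean n B S e\<bar> \<le> \<eta> * 1" unfolding *(4) abs_mult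
        using psubset.IH[OF *(2,3)] abs_y[of j] *(1) \<eta> by (intro mult_mono) auto
      then show ?thesis using \<eta> by auto
    qed
  qed
  then show "\<bar>path_mean n B S e\<bar> \<le> 1" "S \<noteq> {} \<Longrightarrow> \<bar>path_mean n B S e\<bar> \<le> \<eta>" by auto
qed

text \<open>At most two runs have to be peeled off. A lone run is either even or contributes 0. With
  two runs or more, the first two contribute at most \<open>x 1 ^ 2\<close>, and a further factor
  \<eta> comes from a third run or from a run whose length is not 2; only two runs of length 2
  escape.\<close>

lemma path_mean_cases:
  assumes "S \<subseteq> {..<e}"
  obtains (empty) "S = {}"
  | (single) a k where "k \<ge> 1" "a + 2 * k \<le> e" "S = {a..<a + 2 * k}"
  | (pair) a b where "a + 3 \<le> b" "b + 2 \<le> e" "S = {a, Suc a, b, Suc b}"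
  | (small) "\<bar>path_mean n B S e\<bar> \<le> \<eta> * x 1 ^ 2"
proof (cases "S = {}")
  case False
  then obtain a j S' where 1: "j \<ge> 1" "S = {a..<a + j} \<union> S'" "S' \<subseteq> {Suc (a + j)..}" "a + j \<le> e"
    "S' \<subseteq> {..<e}" "path_mean n B S e = y j * path_mean n B S' e"
    using split_first_run[OF assms] by metis
  show ?thesis
  proof (cases "S' = {}")
    case True
    show ?thesis
    proof (cases "even j")
      case True
      then obtain k where "j = 2 * k" by (auto elim: evenE)
      with 1 \<open>S' = {}\<close> single[of k a] show ?thesis by auto
    next
      case False
      then have "path_mean n B S e = 0" using 1 odd_zero by simp
      then show ?thesis using small \<eta> by auto
    qed
  next
    case False
    obtain b j' S'' where 2: "j' \<ge> 1" "S' = {b..<b + j'} \<union> S''" "b + j' \<le> e"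
      "S'' \<subseteq> {..<e}" "path_mean n B S' e = y j' * path_mean n B S'' e"
      using split_first_run[OF 1(5) False] by metis
    have eq: "path_mean n B S e = (y j * y j') * path_mean n B S'' e" using 1 2 by simp
    show ?thesis
    proof (cases "S'' = {}")
      case False
      then have "\<bar>path_mean n B S e\<bar> \<le> x 1 ^ 2 * \<eta>"
        unfolding eq abs_mult[of "y j * y j'"] using abs_y_mult(1)[of j j'] abs_path_mean(2)[OF 2(4)] 1(1) 2(1)
        by (intro mult_mono) auto
      then show ?thesis using small by (simp add: mult_ac)
    next
      case True
      then have F: "path_mean n B S e = y j * y j'" using n by (simp add: eq path_mean_empty)
      show ?thesis
      proof (cases "(j, j') = (2, 2)")
        case True
        have "b \<in> S'" using 2 by auto
        then have "a + 3 \<le> b" using 1 True by auto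
        moreover have "S = {a, Suc a, b, Suc b}"
          using 1(2) 2(2) True \<open>S'' = {}\<close> by (auto simp: less_Suc_eq)
        ultimately show ?thesis using pair[of a b] 2(3) True by auto
      next
        case False
        then show ?thesis using small F abs_y_mult(2)[OF 1(1) 2(1)] by simp
      qed
    qed
  qed
qed (use empty in auto)

lemma path_mean_single:
  assumes "a + 2 * k \<le> e"
  shows "path_mean n B {a..<a + 2 * k} e = (- 1) ^ k * x k"
  using path_mean_split[OF n, of "{a..<a + 2 * k}" a "2 * k" "{}" e B] assms n
  by (simp add: path_mean_empty even_moment)

lemma path_mean_pair:
  assumes "a + 3 \<le> b" "b + 2 \<le> e"
  shows "path_mean n B {a, Suc a, b, Suc b} e = x 1 ^ 2"
proof -
  have b: "{b, Suc b} = {b..<b + 2 * 1}" by auto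
  have y2: "y 2 = - x 1" using even_moment[of 1] by simp
  have "path_mean n B {a, Suc a, b, Suc b} e = y 2 * path_mean n B {b, Suc b} e"
    using assms by (intro path_mean_split[OF n, of _ a]) auto
  also have "path_mean n B {b, Suc b} e = - x 1"
    unfolding b using assms by (subst path_mean_single) auto
  finally show ?thesis by (simp add: y2 power2_eq_square)
qed

end

section \<open>Leading terms of the expansion\<close>

definition run_count :: "(nat \<Rightarrow> int) \<Rightarrow> nat \<Rightarrow> nat \<Rightarrow> int" where
  "run_count \<sigma> e k = (\<Sum>a | a + 2 * k \<le> e. \<Prod>i\<in>{a..<a + 2 * k}. \<sigma> i)"

text \<open>Like \<open>run_count\<close> for the paths on 2k + 1 vertices, this is the signed count
  of 2P3 in terms of edge positions. The two copies occupy the vertices a to a + 2 and b to b + 2,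
  so vertex-disjointness requires a distance of 3, not just 2 as for disjoint edges.\<close>

definition pair_count :: "(nat \<Rightarrow> int) \<Rightarrow> nat \<Rightarrow> int" where
  "pair_count \<sigma> e = (\<Sum>(a, b) | a + 3 \<le> b \<and> b + 2 \<le> e. \<sigma> a * \<sigma> (Suc a) * (\<sigma> b * \<sigma> (Suc b)))"

text \<open>The minimum of the set is a and its maximum is b + 1.\<close>

lemma inj_on_pair_set: "inj_on (\<lambda>(a, b). {a, Suc a, b, Suc b}) {(a, b :: nat). a + 3 \<le> b}"
proof (rule inj_onI, clarify)
  fix a b a' b' :: nat
  assume A: "a + 3 \<le> b" "a' + 3 \<le> b'" and eq: "{a, Suc a, b, Suc b} = {a', Suc a', b', Suc b'}"
  have "Min {a, Suc a, b, Suc b} = a" "Min {a', Suc a', b', Suc b'} = a'"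
    using A by (auto intro!: Min_eqI)
  moreover have "Max {a, Suc a, b, Suc b} = Suc b" "Max {a', Suc a', b', Suc b'} = Suc b'"
    using A by (auto intro!: Max_eqI)
  ultimately show "a = a' \<and> b = b'" using eq by (metis Suc_inject)
qed

context moments
begin

lemma path_expansion_bound:
  fixes \<sigma> :: "nat \<Rightarrow> int"
  assumes \<sigma>: "\<And>i. \<bar>\<sigma> i\<bar> = 1"
  shows "\<bar>(\<Sum>S\<in>Pow {..<e}. 2 ^ card S * (\<Prod>i\<in>S. real_of_int (\<sigma> i)) * path_mean n B S e)
      - (1 + (\<Sum>k=1..e. 4 ^ k * (- 1) ^ k * run_count \<sigma> e k * x k) + 16 * pair_count \<sigma> e * x 1 ^ 2)\<bar>
      \<le> 4 ^ e * \<eta> * x 1 ^ 2"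
proof -
  define f where "f S = 2 ^ card S * (\<Prod>i\<in>S. real_of_int (\<sigma> i)) * path_mean n B S e" for S
  define KA where "KA = (SIGMA k:{1..e}. {a. a + 2 * k \<le> e})"
  define AB where "AB = {(a, b). a + 3 \<le> b \<and> b + 2 \<le> e}"
  define I where "I = (\<lambda>(k, a). {a..<a + 2 * k}) ` KA"
  define J where "J = (\<lambda>(a, b). {a, Suc a, b, Suc b}) ` AB"
  define R where "R = Pow {..<e} - {{}} - I - J"
  have finA: "finite {a. a + 2 * k \<le> e}" for k by (rule finite_subset[of _ "{..e}"]) auto
  have finAB: "finite AB" by (rule finite_subset[of _ "{..e} \<times> {..e}"]) (auto simp: AB_def)
  have finKA: "finite KA" unfolding KA_def using finA by auto
  have fin: "finite I" "finite J" "finite R"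
    using finKA finAB by (auto simp: I_def J_def R_def)
  have injI: "inj_on (\<lambda>(k, a). {a..<a + 2 * k}) KA"
    by (auto simp: inj_on_def KA_def atLeastLessThan_eq_iff)
  have injJ: "inj_on (\<lambda>(a, b). {a, Suc a, b, Suc b}) AB"
    by (rule inj_on_subset[OF inj_on_pair_set]) (auto simp: AB_def)
  \<comment> \<open>A pair omits a + 2 while containing elements on both sides of it, which no
    interval does; so single runs and pairs are different subsets.\<close>
  have J_no: "Suc (Suc a) \<notin> S \<and> a \<in> S \<and> b \<in> S \<and> Suc (Suc a) < b"
    if "S = {a, Suc a, b, Suc b}" "(a, b) \<in> AB" for S a b
    using that by (auto simp: AB_def)
  have disjIJ: "I \<inter> J = {}"
  proof -
    have False if IJ: "S \<in> I" "S \<in> J" for S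
    proof -
      obtain k a where S: "S = {a..<a + 2 * k}" using IJ(1) by (auto simp: I_def)
      obtain c d where "S = {c, Suc c, d, Suc d}" "(c, d) \<in> AB" using IJ(2) by (auto simp: J_def)
      from J_no[OF this] show False unfolding S by auto
    qed
    then show ?thesis by auto
  qed
  have I0: "{} \<notin> I" and J0: "{} \<notin> J" by (auto simp: I_def J_def KA_def)
  have subI: "I \<subseteq> Pow {..<e}" by (auto simp: I_def KA_def)
  have subJ: "J \<subseteq> Pow {..<e}" by (auto simp: J_def AB_def)
  have Pow_eq: "Pow {..<e} = {{}} \<union> (I \<union> (J \<union> R))" using subI subJ by (auto simp: R_def)
  have R_disj: "{} \<notin> R" "I \<inter> R = {}" "J \<inter> R = {}" by (auto simp: R_def)
  have "(\<Sum>S\<in>Pow {..<e}. f S) = f {} + (sum f I + (sum f J + sum f R))"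
    unfolding Pow_eq using fin I0 J0 disjIJ
    by (simp add: sum.union_disjoint R_disj Int_Un_distrib)
  moreover have "f {} = 1" using n by (simp add: f_def path_mean_empty)
  moreover have "sum f I = (\<Sum>k=1..e. 4 ^ k * (- 1) ^ k * run_count \<sigma> e k * x k)"
  proof -
    have "sum f I = (\<Sum>(k, a)\<in>KA. f {a..<a + 2 * k})"
      unfolding I_def by (subst sum.reindex[OF injI]) (auto simp: case_prod_unfold)
    also have "\<dots> = (\<Sum>k=1..e. \<Sum>a | a + 2 * k \<le> e. f {a..<a + 2 * k})"
      unfolding KA_def by (subst sum.Sigma) (auto simp: finA)
    also have "\<dots> = (\<Sum>k=1..e. \<Sum>a | a + 2 * k \<le> e. 4 ^ k * (- 1) ^ k * (\<Prod>i\<in>{a..<a + 2 * k}. real_of_int (\<sigma> i)) * x k)"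
    proof (intro sum.cong refl)
      fix k a assume "a \<in> {a. a + 2 * k \<le> e}"
      then have "path_mean n B {a..<a + 2 * k} e = (- 1) ^ k * x k" by (intro path_mean_single) simp
      moreover have "(2::real) ^ (2 * k) = 4 ^ k" by (simp add: power_mult)
      ultimately show "f {a..<a + 2 * k} = 4 ^ k * (- 1) ^ k * (\<Prod>i\<in>{a..<a + 2 * k}. real_of_int (\<sigma> i)) * x k"
        by (simp add: f_def)
    qed
    finally show ?thesis by (simp add: run_count_def sum_distrib_left sum_distrib_right)
  qed
  moreover have "sum f J = 16 * pair_count \<sigma> e * x 1 ^ 2"
  proof -
    have "sum f J = (\<Sum>(a, b)\<in>AB. f {a, Suc a, b, Suc b})"
      unfolding J_def by (subst sum.reindex[OF injJ]) (auto simp: case_prod_unfold)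
    also have "\<dots> = (\<Sum>(a, b)\<in>AB. 16 * (\<sigma> a * \<sigma> (Suc a) * (\<sigma> b * \<sigma> (Suc b))) * x 1 ^ 2)"
      by (intro sum.cong refl) (auto simp: AB_def f_def path_mean_pair)
    moreover have "pair_count \<sigma> e = (\<Sum>(a, b)\<in>AB. \<sigma> a * \<sigma> (Suc a) * (\<sigma> b * \<sigma> (Suc b)))"
      by (simp add: pair_count_def AB_def)
    ultimately show ?thesis
      by (simp add: sum_distrib_left sum_distrib_right case_prod_unfold)
  qed
  moreover have "\<bar>sum f R\<bar> \<le> 4 ^ e * \<eta> * x 1 ^ 2"
  proof -
    have "\<bar>f S\<bar> \<le> 2 ^ e * (\<eta> * x 1 ^ 2)" if "S \<in> R" for S
    proof -
      have sub: "S \<subseteq> {..<e}" using that by (auto simp: R_def)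
      then have "card S \<le> e" using card_mono[of "{..<e}" S] by auto
      then have pow: "(2::real) ^ card S \<le> 2 ^ e" by (intro power_increasing) auto
      have "\<bar>\<Prod>i\<in>S. real_of_int (\<sigma> i)\<bar> = 1"
        by (simp add: abs_prod of_int_abs[symmetric] \<sigma> del: of_int_abs)
      then have "\<bar>f S\<bar> = 2 ^ card S * \<bar>path_mean n B S e\<bar>" by (simp add: f_def abs_mult)
      also have "\<bar>path_mean n B S e\<bar> \<le> \<eta> * x 1 ^ 2"
        using sub
      proof (cases rule: path_mean_cases)
        case (single a k)
        then have "(k, a) \<in> KA" by (auto simp: KA_def)
        then have "S \<in> I" using single by (force simp: I_def)
        then show ?thesis using that by (auto simp: R_def)
      next
        case (pair a b)
        then have "(a, b) \<in> AB" by (auto simp: AB_def)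
        then have "S \<in> J" using pair by (force simp: J_def)
        then show ?thesis using that by (auto simp: R_def)
      qed (use that in \<open>auto simp: R_def\<close>)
      then have "2 ^ card S * \<bar>path_mean n B S e\<bar> \<le> 2 ^ e * (\<eta> * x 1 ^ 2)"
        using pow \<eta> by (intro mult_mono) auto
      finally show ?thesis .
    qed
    then have "\<bar>sum f R\<bar> \<le> (\<Sum>S\<in>R. 2 ^ e * (\<eta> * x 1 ^ 2))"
      by (intro order.trans[OF sum_abs] sum_mono)
    also have "\<dots> = card R * (2 ^ e * (\<eta> * x 1 ^ 2))" by simp
    \<comment> \<open>There are at most 2^e remaining subsets, each with a weight of at most 2^e:
      hence the constant 4^e.\<close>
    also have "\<dots> \<le> 2 ^ e * (2 ^ e * (\<eta> * x 1 ^ 2))"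
    proof -
      have "card R \<le> card (Pow {..<e})" by (rule card_mono) (auto simp: R_def)
      then have "card R \<le> 2 ^ e" by (simp add: card_Pow)
      then have "real (card R) \<le> 2 ^ e" using of_nat_mono by fastforce
      then show ?thesis using \<eta> by (intro mult_right_mono) auto
    qed
    also have "\<dots> = 4 ^ e * \<eta> * x 1 ^ 2"
      by (simp add: mult.assoc[symmetric] power_mult_distrib[symmetric])
    finally show ?thesis .
  qed
  ultimately show ?thesis unfolding f_def[symmetric] by linarith
qed

end


section \<open>Moments of skew-symmetric kernels\<close>

text \<open>For skew-symmetric B this is the k-th moment of the spectral measure of -(B/n)^2 at the
  normalized constant vector.\<close>

definition moment :: "nat \<Rightarrow> (nat \<Rightarrow> nat \<Rightarrow> real) \<Rightarrow> nat \<Rightarrow> real" where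
  "moment n B k = avg n (\<lambda>i. (pw n B k i)\<^sup>2)"

text \<open>Log-convexity makes the ratios of consecutive terms nondecreasing. One ratio q > 1 would
  therefore force geometric growth from there on, against the bound.\<close>

lemma log_convex_bounded_decreasing:
  fixes z :: "nat \<Rightarrow> real"
  assumes nn: "\<And>k. 0 \<le> z k" and lc: "\<And>k. (z (Suc k))\<^sup>2 \<le> z k * z (Suc (Suc k))" and bd: "\<And>k. z k \<le> K"
  shows "z (Suc k) \<le> z k"
proof (rule ccontr)
  assume "\<not> z (Suc k) \<le> z k"
  then have gt: "z k < z (Suc k)" by simp
  have "0 < z k"
  proof (rule ccontr)
    assume "\<not> 0 < z k"
    then have "z k = 0" using nn[of k] by auto
    then have "(z (Suc k))\<^sup>2 \<le> 0" using lc[of k] by simp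
    then show False using gt nn[of k] by auto
  qed
  define q where "q = z (Suc k) / z k"
  have q: "q > 1" using gt \<open>0 < z k\<close> by (simp add: q_def)
  have step: "0 < z (k + i) \<and> q * z (k + i) \<le> z (Suc (k + i))" for i
  proof (induction i)
    case 0
    then show ?case using \<open>0 < z k\<close> by (simp add: q_def)
  next
    case (Suc i)
    have pos: "0 < z (Suc (k + i))"
      using Suc q by (intro less_le_trans[OF _ conjunct2[OF Suc]]) auto
    have "z (k + i) * (q * z (Suc (k + i))) \<le> z (Suc (k + i)) * z (Suc (k + i))"
      using Suc pos by (simp add: mult_ac mult_left_mono)
    also have "\<dots> \<le> z (k + i) * z (Suc (Suc (k + i)))" using lc[of "k + i"] by (simp add: power2_eq_square)
    finally have "q * z (Suc (k + i)) \<le> z (Suc (Suc (k + i)))"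
      using Suc by (auto dest: mult_left_le_imp_le)
    then show ?case using pos by simp
  qed
  have grow: "q ^ i * z k \<le> z (k + i)" for i
  proof (induction i)
    case (Suc i)
    have "q ^ Suc i * z k = q * (q ^ i * z k)" by simp
    also have "\<dots> \<le> q * z (k + i)" using Suc q by (intro mult_left_mono) auto
    also have "\<dots> \<le> z (k + Suc i)" using step[of i] by simp
    finally show ?case .
  qed simp
  obtain i where "K / z k < q ^ i" using real_arch_pow[OF q] by blast
  then have "K < q ^ i * z k" using \<open>0 < z k\<close> by (simp add: pos_divide_less_eq)
  then show False using grow[of i] bd[of "k + i"] by linarith
qed

locale skew_kernel =
  fixes n :: nat and B :: "nat \<Rightarrow> nat \<Rightarrow> real"
  assumes n: "n > 0" and skew: "i < n \<Longrightarrow> j < n \<Longrightarrow> B i j = - B j i"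
begin

text \<open>Moving one factor B to the other side of the inner product changes the sign.\<close>

lemma avg_pw_shift: "avg n (\<lambda>i. pw n B (Suc j) i * pw n B m i) = - avg n (\<lambda>i. pw n B j i * pw n B (Suc m) i)"
proof -
  have "(\<Sum>i<n. (\<Sum>l<n. pw n B j l * B l i) * pw n B m i) = (\<Sum>l<n. \<Sum>i<n. pw n B j l * B l i * pw n B m i)"
    unfolding sum_distrib_right by (rule sum.swap)
  also have "\<dots> = (\<Sum>l<n. \<Sum>i<n. - (pw n B j l * (pw n B m i * B i l)))"
  proof (intro sum.cong refl)
    fix l i assume "l \<in> {..<n}" "i \<in> {..<n}"
    then show "pw n B j l * B l i * pw n B m i = - (pw n B j l * (pw n B m i * B i l))"
      using skew[of l i] by simp
  qed
  finally show ?thesis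
    by (simp add: avg_def sum_divide_distrib[symmetric] sum_negf sum_distrib_left)
qed

text \<open>The j steps are moved across one by one, each with a sign. The case j = m turns even
  walk means into moments, and m = 0 makes every odd walk mean its own negative.\<close>

lemma avg_pw_add: "avg n (pw n B (j + m)) = (- 1) ^ j * avg n (\<lambda>i. pw n B j i * pw n B m i)"
proof (induction j arbitrary: m)
  case (Suc j)
  have "avg n (pw n B (Suc j + m)) = avg n (pw n B (j + Suc m))" by (simp del: walk.simps)
  also have "\<dots> = (- 1) ^ j * avg n (\<lambda>i. pw n B j i * pw n B (Suc m) i)" by (rule Suc.IH)
  also have "\<dots> = (- 1) ^ Suc j * avg n (\<lambda>i. pw n B (Suc j) i * pw n B m i)"
    using avg_pw_shift[of j m] by simp
  finally show ?case .
qed simp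

lemma avg_pw_even: "avg n (pw n B (2 * k)) = (- 1) ^ k * moment n B k"
  using avg_pw_add[of k k] by (simp add: moment_def power2_eq_square mult_2)

lemma avg_pw_odd: "odd j \<Longrightarrow> avg n (pw n B j) = 0"
  using avg_pw_add[of j 0] by simp

lemma moment_0: "moment n B 0 = 1"
  using n by (simp add: moment_def)

lemma moment_nonneg: "0 \<le> moment n B k"
  by (simp add: moment_def avg_def sum_nonneg)

text \<open>The shift turns the middle moment into an inner product of the walk vectors at k and k +
  2, to which Cauchy-Schwarz applies.\<close>

lemma moment_log_convex: "(moment n B (Suc k))\<^sup>2 \<le> moment n B k * moment n B (Suc (Suc k))"
proof -
  have "moment n B (Suc k) = - avg n (\<lambda>i. pw n B k i * pw n B (Suc (Suc k)) i)"
    unfolding moment_def power2_eq_square by (rule avg_pw_shift)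
  then have "(moment n B (Suc k))\<^sup>2 = (\<Sum>i<n. pw n B k i * pw n B (Suc (Suc k)) i)\<^sup>2 / (real n)\<^sup>2"
    by (simp add: avg_def power_divide del: walk.simps)
  also have "\<dots> \<le> ((\<Sum>i<n. (pw n B k i)\<^sup>2) * (\<Sum>i<n. (pw n B (Suc (Suc k)) i)\<^sup>2)) / (real n)\<^sup>2"
    by (intro divide_right_mono Cauchy_Schwarz_ineq_sum) auto
  also have "\<dots> = moment n B k * moment n B (Suc (Suc k))"
    by (simp add: moment_def avg_def power2_eq_square del: walk.simps)
  finally show ?thesis .
qed

text \<open>The constant K may depend on n and B. Only the growth rate matters, since
  \<open>moment_Suc\<close> uses nothing but boundedness of the rescaled moments.\<close>

lemma pw_bound:
  assumes \<epsilon>: "\<epsilon> > 0" and C: "C \<in> carrier_mat n n" "\<And>i j. i < n \<Longrightarrow> j < n \<Longrightarrow> C $$ (i, j) = complex_of_real (B i j)"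
    and sr: "spectral_radius C \<le> \<epsilon> * real n"
  shows "\<exists>K. \<forall>k. \<forall>i<n. \<bar>pw n B k i\<bar> \<le> K * (2 * \<epsilon>) ^ k"
proof -
  define c where "c = 2 * \<epsilon> * real n"
  have c: "c > 0" using \<epsilon> n by (simp add: c_def)
  define N where "N = complex_of_real (1 / c) \<cdot>\<^sub>m C"
  have N: "N \<in> carrier_mat n n" using C by (simp add: N_def)
  have "spectral_radius N \<in> norm ` spectrum N" by (rule spectral_radius_mem_max(1)[OF N n])
  then obtain l where l: "spectral_radius N = norm l" "eigenvalue N l" by (auto simp: spectrum_def)
  from l(2) obtain v where v: "v \<in> carrier_vec n" "v \<noteq> 0\<^sub>v n" "N *\<^sub>v v = l \<cdot>\<^sub>v v"
    using N by (auto simp: eigenvalue_def eigenvector_def)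
  have "C *\<^sub>v v = complex_of_real c \<cdot>\<^sub>v (N *\<^sub>v v)"
    using c C(1) v(1) by (intro eq_vecI) (auto simp: N_def scalar_prod_def sum_distrib_left)
  then have "C *\<^sub>v v = (complex_of_real c * l) \<cdot>\<^sub>v v" using v by (simp add: smult_smult_assoc)
  then have "eigenvalue C (complex_of_real c * l)"
    using v C by (auto simp: eigenvalue_def eigenvector_def)
  then have "norm (complex_of_real c * l) \<le> spectral_radius C"
    by (intro spectral_radius_mem_max(2)[OF C(1) n]) (auto simp: spectrum_def)
  then have "c * norm l \<le> \<epsilon> * real n" using sr c by (simp add: norm_mult)
  then have "norm l \<le> 1 / 2" using \<epsilon> n by (simp add: c_def)
  then have "spectral_radius N < 1" using l by simp
  then obtain K where K: "\<And>k. norm_bound (N ^\<^sub>m k) K"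
    using spectral_radius_jnf_norm_bound_less_1_upper_triangular[OF N] by blast
  \<comment> \<open>The column sums of the k-th power of N are the walk vector up to scaling: a walk
    step divides by n, a factor N divides by c.\<close>
  have col: "(\<Sum>l<n. (N ^\<^sub>m k) $$ (l, i)) = complex_of_real (pw n B k i * (real n / c) ^ k)" if "i < n" for k i
    using that
  proof (induction k arbitrary: i)
    case 0
    then show ?case using N by (simp add: sum.If_cases)
  next
    case (Suc k)
    have Nk: "N ^\<^sub>m k \<in> carrier_mat n n" using N by simp
    have "(\<Sum>l<n. (N ^\<^sub>m Suc k) $$ (l, i)) = (\<Sum>l<n. \<Sum>m<n. (N ^\<^sub>m k) $$ (l, m) * N $$ (m, i))"
      using N Nk Suc.prems by (intro sum.cong refl) (auto simp: scalar_prod_def atLeast0LessThan)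
    also have "\<dots> = (\<Sum>m<n. (\<Sum>l<n. (N ^\<^sub>m k) $$ (l, m)) * N $$ (m, i))"
      unfolding sum_distrib_right by (rule sum.swap)
    also have "\<dots> = (\<Sum>m<n. complex_of_real (pw n B k m * (real n / c) ^ k) * complex_of_real (B m i / c))"
      using Suc C by (intro sum.cong refl) (auto simp: N_def)
    also have "\<dots> = complex_of_real ((\<Sum>m<n. pw n B k m * B m i) * ((real n / c) ^ k / c))"
      by (simp add: sum_distrib_left sum_distrib_right mult_ac sum_divide_distrib)
    also have "(\<Sum>m<n. pw n B k m * B m i) * ((real n / c) ^ k / c) = pw n B (Suc k) i * (real n / c) ^ Suc k"
      using n by (simp add: avg_def)
    finally show ?case .
  qed
  have "\<bar>pw n B k i\<bar> \<le> (real n * K) * (2 * \<epsilon>) ^ k" if i: "i < n" for k i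
  proof -
    have "\<bar>pw n B k i * (real n / c) ^ k\<bar> = norm (\<Sum>l<n. (N ^\<^sub>m k) $$ (l, i))"
      unfolding col[OF i] by (simp only: norm_of_real)
    also have "\<dots> \<le> (\<Sum>l<n. K)"
      using K[of k] i N by (intro sum_norm_le) (auto simp: norm_bound_def)
    finally have "\<bar>pw n B k i * (real n / c) ^ k\<bar> \<le> real n * K" by simp
    moreover have "real n / c = 1 / (2 * \<epsilon>)" using n \<epsilon> by (simp add: c_def)
    ultimately show ?thesis using \<epsilon> by (simp add: abs_mult power_divide field_simps)
  qed
  then show ?thesis by blast
qed

text \<open>The factor \<open>2\<close> makes the spectral radius of the scaled kernel less than \<open>1\<close>, so its powers are
  bounded; for a log-convex sequence boundedness already forces monotonicity.\<close>

lemma moment_Suc: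
  assumes \<epsilon>: "\<epsilon> > 0" and C: "C \<in> carrier_mat n n" "\<And>i j. i < n \<Longrightarrow> j < n \<Longrightarrow> C $$ (i, j) = complex_of_real (B i j)"
    and sr: "spectral_radius C \<le> \<epsilon> * real n"
  shows "moment n B (Suc k) \<le> (2 * \<epsilon>)\<^sup>2 * moment n B k"
proof -
  obtain K where K: "\<And>k i. i < n \<Longrightarrow> \<bar>pw n B k i\<bar> \<le> K * (2 * \<epsilon>) ^ k"
    using pw_bound[OF assms] by blast
  define \<eta> where "\<eta> = (2 * \<epsilon>)\<^sup>2"
  have \<eta>: "\<eta> > 0" using \<epsilon> by (simp add: \<eta>_def)
  define z where "z k = moment n B k / \<eta> ^ k" for k
  have "z (Suc k) \<le> z k"
  proof (rule log_convex_bounded_decreasing)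
    show "0 \<le> z k" for k using \<eta> by (simp add: z_def moment_nonneg)
    show "(z (Suc k))\<^sup>2 \<le> z k * z (Suc (Suc k))" for k
    proof -
      have "(\<eta> ^ Suc k)\<^sup>2 = \<eta> ^ k * \<eta> ^ Suc (Suc k)" by (simp add: power2_eq_square)
      then show ?thesis using divide_right_mono[OF moment_log_convex[of k], of "(\<eta> ^ Suc k)\<^sup>2"] \<eta>
        by (simp add: z_def power_divide)
    qed
    show "z k \<le> K\<^sup>2" for k
    proof -
      have "moment n B k \<le> avg n (\<lambda>_. (K * (2 * \<epsilon>) ^ k)\<^sup>2)"
        unfolding moment_def avg_def
      proof (intro divide_right_mono sum_mono)
        fix i assume "i \<in> {..<n}"
        then have "\<bar>pw n B k i\<bar> \<le> K * (2 * \<epsilon>) ^ k" using K by simp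
        then show "(pw n B k i)\<^sup>2 \<le> (K * (2 * \<epsilon>) ^ k)\<^sup>2" by (metis abs_ge_zero power2_abs power_mono)
      qed auto
      also have "\<dots> = K\<^sup>2 * \<eta> ^ k"
      proof -
        have "((2 * \<epsilon>) ^ k)\<^sup>2 = \<eta> ^ k"
          unfolding \<eta>_def by (simp only: power_mult[symmetric] mult.commute)
        then show ?thesis using n by (simp add: power_mult_distrib[of K])
      qed
      finally show ?thesis using \<eta> by (simp add: z_def pos_divide_le_eq)
    qed
  qed
  then show ?thesis using \<eta> unfolding \<eta>_def[symmetric] by (simp add: z_def field_simps)
qed

end

abbreviation skew_entry :: "real mat \<Rightarrow> nat \<Rightarrow> nat \<Rightarrow> real" where
  "skew_entry A \<equiv> \<lambda>i j. skew_part A $$ (i, j)"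

lemma skew_entry:
  assumes "weighted_tournament n A" "i < n" "j < n"
  shows "skew_entry A i j = A $$ (i, j) - 1 / 2"
  using assms by (auto simp: weighted_tournament_def skew_part_def all_ones_mat_def)

lemma skew_kernel_tournament:
  assumes "weighted_tournament n A" "n > 0"
  shows "skew_kernel n (skew_entry A)"
proof
  fix i j assume ij: "i < n" "j < n"
  then have "A $$ (i, j) + A $$ (j, i) = 1" using assms by (auto simp: weighted_tournament_def)
  then show "skew_entry A i j = - skew_entry A j i"
    using skew_entry[OF assms(1)] ij by simp
qed fact

lemma moments_tournament:
  assumes A: "weighted_tournament n A" and n: "n > 0" and \<epsilon>: "0 < \<epsilon>" "\<epsilon> \<le> 1 / 2"
    and sr: "lambda_max (skew_part A) \<le> \<epsilon> * real n"
  shows "moments n (skew_entry A) (moment n (skew_entry A)) ((2 * \<epsilon>)\<^sup>2)"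
proof -
  interpret skew_kernel n "skew_entry A" by (rule skew_kernel_tournament[OF A n])
  have car: "skew_part A \<in> carrier_mat n n"
    using A by (auto simp: weighted_tournament_def skew_part_def all_ones_mat_def)
  show ?thesis
  proof
    show "moment n (skew_entry A) (Suc k) \<le> (2 * \<epsilon>)\<^sup>2 * moment n (skew_entry A) k" for k
    proof (rule moment_Suc)
      show "map_mat complex_of_real (skew_part A) \<in> carrier_mat n n" using car by simp
      show "spectral_radius (map_mat complex_of_real (skew_part A)) \<le> \<epsilon> * real n"
        using sr by (simp add: lambda_max_def)
    qed (use car \<epsilon> in auto)
    show "(2 * \<epsilon>)\<^sup>2 \<le> 1" by (rule power_le_one) (use \<epsilon> in auto)
  qed (use n avg_pw_odd avg_pw_even moment_0 moment_nonneg in auto)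
qed


section \<open>Rank-two tournaments\<close>

lemma avg_4: "avg 4 f = (f 0 + f 1 + f 2 + f 3) / 4"
  by (simp add: avg_def eval_nat_numeral)

text \<open>For an eigenvector v, each |l| |v_i| is at most \<beta> times the sum of all |v_j|.
  Summing over i and dividing by that sum gives the bound.\<close>

lemma spectral_radius_le_entries:
  assumes C: "C \<in> carrier_mat n n" and n: "n > 0"
    and \<beta>: "\<And>i j. i < n \<Longrightarrow> j < n \<Longrightarrow> norm (C $$ (i, j)) \<le> \<beta>"
  shows "spectral_radius C \<le> real n * \<beta>"
proof -
  have "spectral_radius C \<in> norm ` spectrum C" by (rule spectral_radius_mem_max(1)[OF C n])
  then obtain l where l: "spectral_radius C = norm l" "eigenvalue C l" by (auto simp: spectrum_def)
  from l(2) obtain v where v: "v \<in> carrier_vec n" "v \<noteq> 0\<^sub>v n" "C *\<^sub>v v = l \<cdot>\<^sub>v v"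
    using C by (auto simp: eigenvalue_def eigenvector_def)
  define V where "V = (\<Sum>j<n. norm (v $ j))"
  obtain j where j: "j < n" "v $ j \<noteq> 0"
    using v(1,2) by (metis eq_vecI carrier_vecD index_zero_vec)
  have "V \<noteq> 0" using j by (subst V_def, subst sum_nonneg_eq_0_iff) auto
  moreover have "V \<ge> 0" by (simp add: V_def sum_nonneg)
  ultimately have V: "V > 0" by simp
  have "norm l * norm (v $ i) \<le> \<beta> * V" if i: "i < n" for i
  proof -
    have "l * v $ i = (C *\<^sub>v v) $ i" using v i by simp
    also have "\<dots> = (\<Sum>j<n. C $$ (i, j) * v $ j)"
      using C v(1) i by (simp add: scalar_prod_def atLeast0LessThan)
    finally have "norm l * norm (v $ i) = norm (\<Sum>j<n. C $$ (i, j) * v $ j)"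
      by (metis norm_mult)
    also have "\<dots> \<le> (\<Sum>j<n. \<beta> * norm (v $ j))"
      using \<beta> i by (intro sum_norm_le) (auto simp: norm_mult intro!: mult_right_mono)
    finally show ?thesis by (simp add: V_def sum_distrib_left)
  qed
  then have "(\<Sum>i<n. norm l * norm (v $ i)) \<le> (\<Sum>i<n. \<beta> * V)" by (intro sum_mono) auto
  then have "norm l * V \<le> (real n * \<beta>) * V" by (simp add: V_def sum_distrib_left mult.assoc)
  then show ?thesis using V l(1) by simp
qed

text \<open>The constant vector and the sign vectors (1, 1, -1, -1) and (1, -1, 1, -1) are
  orthogonal; four vertices make room for them. In B = u v^T - v u^T only u meets the constant
  vector, with mean \<tau>, so \<tau> controls the mass and \<delta> the location: the moments are
  those of a mass \<tau>^2 / (1 + \<tau>^2) at the point \<delta>^2 (1 + \<tau>^2), the rest of the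
  mass being at 0.\<close>

lemma rank_two_tournament:
  fixes \<tau> \<delta> :: real
  assumes \<tau>: "0 < \<tau>" "\<tau> \<le> 1" and \<delta>: "0 < \<delta>" "\<delta> \<le> 1 / 8"
  obtains A where "weighted_tournament 4 A" "lambda_max (skew_part A) \<le> 16 * \<delta>"
    "\<And>k. moment 4 (skew_entry A) (Suc k) = \<tau>\<^sup>2 * \<delta>\<^sup>2 * (\<delta>\<^sup>2 * (1 + \<tau>\<^sup>2)) ^ k"
proof -
  define u where "u i = \<tau> + (if i < 2 then 1 else - 1)" for i :: nat
  define v where "v i = \<delta> * (if even i then 1 else - 1)" for i :: nat
  define B where "B i j = u i * v j - v i * u j" for i j
  define A where "A = mat 4 4 (\<lambda>(i, j). 1 / 2 + B i j)"
  define s where "s = \<delta>\<^sup>2 * (1 + \<tau>\<^sup>2)"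
  \<comment> \<open>As \<delta> is at most 1/8, this keeps the entries 1/2 + B within [0, 1]; with
    four columns it also yields the spectral bound 16 \<delta>.\<close>
  have B_le: "\<bar>B i j\<bar> \<le> 4 * \<delta>" for i j
  proof -
    have "\<bar>u i\<bar> \<le> 2" for i using \<tau> by (auto simp: u_def)
    moreover have "\<bar>v i\<bar> \<le> \<delta>" for i using \<delta> by (auto simp: v_def)
    ultimately have "\<bar>u i * v j\<bar> \<le> 2 * \<delta>" for i j
      unfolding abs_mult by (intro mult_mono) auto
    from this[of i j] this[of j i] show ?thesis by (simp add: B_def mult.commute)
  qed
  have wt: "weighted_tournament 4 A"
    unfolding weighted_tournament_def
  proof (intro conjI allI impI)
    fix i j :: nat assume ij: "i < 4" "j < 4"
    have "\<bar>B i j\<bar> \<le> 1 / 2" using B_le[of i j] \<delta> by linarith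
    then show "0 \<le> A $$ (i, j)" "A $$ (i, j) \<le> 1" using ij by (auto simp: A_def)
    show "A $$ (i, j) + A $$ (j, i) = 1" using ij by (simp add: A_def B_def)
  qed (simp add: A_def)
  have entry: "skew_entry A i j = B i j" if "i < 4" "j < 4" for i j
    using skew_entry[OF wt that] that by (simp add: A_def)
  have "spectral_radius (map_mat complex_of_real (skew_part A)) \<le> real 4 * (4 * \<delta>)"
    using B_le entry wt
    by (intro spectral_radius_le_entries)
       (auto simp: weighted_tournament_def skew_part_def all_ones_mat_def)
  then have lam: "lambda_max (skew_part A) \<le> 16 * \<delta>" by (simp add: lambda_max_def)
  let ?p = "pw 4 (skew_entry A)"
  have step: "?p (Suc k) j = avg 4 (\<lambda>i. ?p k i * B i j)" if "j < 4" for k j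
    using that by (simp add: avg_def entry)
  \<comment> \<open>On row vectors the kernel sends 1 to \<tau> v, v to -\<delta>^2 u and u to (1 +
    \<tau>^2) v. Two steps within the plane of u and v thus multiply by -s.\<close>
  have pw: "(\<forall>j<4. ?p (Suc (2 * k)) j = \<tau> * (- s) ^ k * v j) \<and>
            (\<forall>j<4. ?p (Suc (Suc (2 * k))) j = - \<tau> * \<delta>\<^sup>2 * (- s) ^ k * u j)" for k
  proof (induction k)
    case 0
    have *: "?p (Suc 0) j = \<tau> * v j" if "j < 4" for j
      unfolding step[OF that] by (simp add: avg_4 B_def u_def v_def algebra_simps)
    have "?p (Suc (Suc 0)) j = - \<tau> * \<delta>\<^sup>2 * u j" if "j < 4" for j
      unfolding step[OF that] avg_4
      by (simp add: * del: walk.simps) (simp add: B_def u_def v_def power2_eq_square algebra_simps)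
    then show ?case using * by simp
  next
    case (Suc k)
    have *: "?p (Suc (2 * Suc k)) j = \<tau> * (- s) ^ Suc k * v j" if "j < 4" for j
    proof -
      have "?p (Suc (2 * Suc k)) j = avg 4 (\<lambda>i. ?p (Suc (Suc (2 * k))) i * B i j)"
        using step[OF that] by (simp del: walk.simps)
      also have "\<dots> = - \<tau> * \<delta>\<^sup>2 * (- s) ^ k * avg 4 (\<lambda>i. u i * B i j)"
        using Suc by (simp add: avg_4 del: walk.simps) (simp add: algebra_simps)
      also have "avg 4 (\<lambda>i. u i * B i j) = (1 + \<tau>\<^sup>2) * v j"
        by (simp add: avg_4 B_def u_def v_def power2_eq_square algebra_simps)
      finally show ?thesis by (simp add: s_def)
    qed
    moreover have "?p (Suc (Suc (2 * Suc k))) j = - \<tau> * \<delta>\<^sup>2 * (- s) ^ Suc k * u j" if "j < 4" for j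
    proof -
      have "?p (Suc (Suc (2 * Suc k))) j = avg 4 (\<lambda>i. ?p (Suc (2 * Suc k)) i * B i j)"
        using step[OF that] by (simp del: walk.simps)
      also have "\<dots> = \<tau> * (- s) ^ Suc k * avg 4 (\<lambda>i. v i * B i j)"
        using * by (simp add: avg_4 del: walk.simps power_Suc) (simp add: algebra_simps)
      also have "avg 4 (\<lambda>i. v i * B i j) = - \<delta>\<^sup>2 * u j"
        by (simp add: avg_4 B_def u_def v_def power2_eq_square field_simps)
      finally show ?thesis by simp
    qed
    ultimately show ?case by blast
  qed
  interpret skew_kernel 4 "skew_entry A" by (rule skew_kernel_tournament[OF wt]) simp
  have "moment 4 (skew_entry A) (Suc k) = \<tau>\<^sup>2 * \<delta>\<^sup>2 * s ^ k" for k
  proof -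
    have "(- 1) ^ Suc k * moment 4 (skew_entry A) (Suc k) = avg 4 (?p (Suc (Suc (2 * k))))"
      using avg_pw_even[of "Suc k"] by simp
    also have "\<dots> = - \<tau> * \<delta>\<^sup>2 * (- s) ^ k * avg 4 u"
      using pw[of k] by (simp add: avg_4 del: walk.simps) (simp add: algebra_simps)
    also have "avg 4 u = \<tau>" by (simp add: avg_4 u_def)
    also have "- \<tau> * \<delta>\<^sup>2 * (- s) ^ k * \<tau> = (- 1) ^ Suc k * (\<tau>\<^sup>2 * \<delta>\<^sup>2 * s ^ k)"
      by (subst power_minus) (simp add: power2_eq_square)
    finally show ?thesis by simp
  qed
  then show ?thesis using that wt lam by (simp add: s_def)
qed


section \<open>Signed counts in oriented paths\<close>

lemma parcs_mk_symmetric_iff: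
  "(u, v) \<in> parcs (mk_symmetric (with_proj G)) \<longleftrightarrow> (u, v) \<in> parcs G \<or> (v, u) \<in> parcs G"
  by (auto simp: parcs_mk_symmetric Bex_def)

text \<open>This turns the parity of the number of reversed edges into a product of edge
  signs.\<close>

lemma minus_one_power_card:
  fixes f :: "'b \<Rightarrow> int"
  assumes "finite X" "\<And>x. x \<in> X \<Longrightarrow> \<bar>f x\<bar> = 1"
  shows "(- 1) ^ card {x \<in> X. f x = - 1} = prod f X"
  using assms
proof (induction X)
  case (insert x X)
  have IH: "(- 1) ^ card {x \<in> X. f x = - 1} = prod f X"
    by (rule insert.IH) (rule insert.prems, simp)
  have "f x = 1 \<or> f x = - 1" using insert.prems[of x] by auto
  then show ?case
  proof
    assume "f x = 1"
    then have "{y \<in> insert x X. f y = - 1} = {y \<in> X. f y = - 1}" by auto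
    then show ?thesis using IH \<open>f x = 1\<close> insert.hyps by (simp only:) simp
  next
    assume "f x = - 1"
    then have "{y \<in> insert x X. f y = - 1} = insert x {y \<in> X. f y = - 1}" by auto
    then show ?thesis using IH \<open>f x = - 1\<close> insert.hyps by (simp only:) simp
  qed
qed simp

text \<open>Turning back would repeat the value taken two steps earlier, against
  injectivity.\<close>

lemma unit_steps_monotone:
  fixes g :: "nat \<Rightarrow> nat"
  assumes "inj_on g {..j}" "\<And>i. i < j \<Longrightarrow> g (Suc i) = Suc (g i) \<or> g i = Suc (g (Suc i))"
  shows "(\<forall>i\<le>j. g i = g 0 + i) \<or> (\<forall>i\<le>j. g i + i = g 0)"
  using assms
proof (induction j)
  case (Suc j)
  have inj: "inj_on g {..j}" using Suc.prems(1) by (rule inj_on_subset) auto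
  have IH: "(\<forall>i\<le>j. g i = g 0 + i) \<or> (\<forall>i\<le>j. g i + i = g 0)"
    using Suc.IH[OF inj] Suc.prems(2) by auto
  have step: "g (Suc j) = Suc (g j) \<or> g j = Suc (g (Suc j))" using Suc.prems(2) by simp
  show ?case
  proof (cases j)
    case 0
    then show ?thesis using step by (simp add: le_Suc_eq) linarith
  next
    case (Suc j')
    have j': "j' \<le> j" "j = j' + 1" using Suc by auto
    have ne: "g (Suc j) \<noteq> g j'"
    proof
      assume "g (Suc j) = g j'"
      from inj_onD[OF Suc.prems(1) this] j' show False by simp
    qed
    show ?thesis
      using IH
    proof
      assume up: "\<forall>i\<le>j. g i = g 0 + i"
      have "g j = g 0 + j" "g j' = g 0 + j'" using up j'(1) by blast+
      then have "g (Suc j) = g 0 + Suc j" using step ne j'(2) by linarith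
      then have "\<forall>i\<le>Suc j. g i = g 0 + i" using up by (metis le_Suc_eq)
      then show ?thesis by blast
    next
      assume down: "\<forall>i\<le>j. g i + i = g 0"
      have "g j + j = g 0" "g j' + j' = g 0" using down j'(1) by blast+
      then have "g (Suc j) + Suc j = g 0" using step ne j'(2) by linarith
      then have "\<forall>i\<le>Suc j. g i + i = g 0" using down by (metis le_Suc_eq)
      then show ?thesis by blast
    qed
  qed
qed simp

lemma parcs_directed_path: "parcs (directed_path (Suc j)) = (\<lambda>u. (u, Suc u)) ` {..<j}"
  by (auto simp: directed_path_def)

lemma parcs_directed_path_iff: "(u, v) \<in> parcs (directed_path (Suc j)) \<longleftrightarrow> v = Suc u \<and> u < j"
  by (auto simp: parcs_directed_path)

lemma pverts_directed_path: "pverts (directed_path (Suc j)) = {..j}"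
  by (auto simp: directed_path_def)

lemma parcs_two_P3: "parcs two_P3 = {(Inl 0, Inl 1), (Inl 1, Inl 2), (Inr 0, Inr 1), (Inr 1, Inr 2)}"
proof -
  have "parcs (directed_path 3) = {(0, 1), (1, 2)}"
    unfolding numeral_3_eq_3 parcs_directed_path by (auto simp: lessThan_Suc numeral_2_eq_2)
  then show ?thesis by (auto simp: two_P3_def disjoint_union_def)
qed

lemma pverts_two_P3: "pverts two_P3 = Inl ` {..2} \<union> Inr ` {..2}"
proof -
  have "pverts (directed_path 3) = {..2}"
    unfolding numeral_3_eq_3 pverts_directed_path by (simp add: numeral_2_eq_2)
  then show ?thesis by (auto simp: two_P3_def disjoint_union_def)
qed

text \<open>Isomorphisms onto the subgraph with edge positions \<open>S\<close>, in terms of positions along the path;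
  edge \<open>i\<close> joins the positions \<open>i\<close> and \<open>i + 1\<close>.\<close>

definition coord_iso :: "('b \<Rightarrow> nat) \<Rightarrow> 'b pair_pre_digraph \<Rightarrow> nat set \<Rightarrow> bool" where
  "coord_iso g G S \<longleftrightarrow> bij_betw g (pverts G) (S \<union> Suc ` S) \<and>
     (\<forall>u\<in>pverts G. \<forall>v\<in>pverts G. (u, v) \<in> parcs G \<or> (v, u) \<in> parcs G \<longleftrightarrow>
        (g v = Suc (g u) \<and> g u \<in> S) \<or> (g u = Suc (g v) \<and> g v \<in> S))"

lemma coord_iso_step:
  assumes "coord_iso g G S" "(u, v) \<in> parcs G" "u \<in> pverts G" "v \<in> pverts G"
  shows "(g v = Suc (g u) \<and> g u \<in> S) \<or> (g u = Suc (g v) \<and> g v \<in> S)"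
  using assms by (auto simp: coord_iso_def)

text \<open>Adjacent vertices have consecutive positions i and i + 1, and the edge between these
  positions carries the index i, their minimum.\<close>

lemma coord_iso_edges:
  assumes g: "coord_iso g G S" and wf: "\<And>u v. (u, v) \<in> parcs G \<Longrightarrow> u \<in> pverts G \<and> v \<in> pverts G"
  shows "S = (\<lambda>(u, v). min (g u) (g v)) ` parcs G"
proof
  show "S \<subseteq> (\<lambda>(u, v). min (g u) (g v)) ` parcs G"
  proof
    fix i assume i: "i \<in> S"
    have "g ` pverts G = S \<union> Suc ` S" using g by (auto simp: coord_iso_def bij_betw_def)
    then obtain u v where uv: "u \<in> pverts G" "v \<in> pverts G" "g u = i" "g v = Suc i"
      using i by (metis UnI1 UnI2 imageE imageI)
    then have "(u, v) \<in> parcs G \<or> (v, u) \<in> parcs G" using g i by (auto simp: coord_iso_def)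
    then show "i \<in> (\<lambda>(u, v). min (g u) (g v)) ` parcs G" 
    proof
      assume "(u, v) \<in> parcs G"
      then show ?thesis using uv by (intro image_eqI[of _ _ "(u, v)"]) auto
    next
      assume "(v, u) \<in> parcs G"
      then show ?thesis using uv by (intro image_eqI[of _ _ "(v, u)"]) auto
    qed
  qed
  show "(\<lambda>(u, v). min (g u) (g v)) ` parcs G \<subseteq> S"
  proof clarify
    fix u v assume "(u, v) \<in> parcs G"
    then show "min (g u) (g v) \<in> S" using coord_iso_step[OF g, of u v] wf[of u v] by auto
  qed
qed

section \<open>Edge subsets of an oriented path and the subgraphs that they span\<close>

locale path_coords =
  fixes D :: "'a pair_pre_digraph" and h :: "nat \<Rightarrow> 'a" and e :: nat and \<sigma> :: "nat \<Rightarrow> int"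
  assumes h: "bij_betw h {..e} (pverts D)"
    and abs_\<sigma>: "\<bar>\<sigma> i\<bar> = 1"
    and parcs_D: "parcs D = (\<lambda>i. if \<sigma> i = 1 then (h i, h (Suc i)) else (h (Suc i), h i)) ` {..<e}"
begin

definition arc :: "nat \<Rightarrow> 'a \<times> 'a" where
  "arc i = (if \<sigma> i = 1 then (h i, h (Suc i)) else (h (Suc i), h i))"

text \<open>The vertices are exactly the end points of the chosen edges, as the absence of isolated
  vertices forces. Subgraphs without isolated vertices thus correspond to sets of edge
  positions.\<close>

definition sub :: "nat set \<Rightarrow> 'a pair_pre_digraph" where
  "sub S = \<lparr>pverts = h ` (S \<union> Suc ` S), parcs = arc ` S\<rparr>"

lemma arcs_D: "parcs D = arc ` {..<e}"
  unfolding parcs_D by (rule image_cong) (simp_all add: arc_def)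

lemma \<sigma>_cases: "\<sigma> i = 1 \<or> \<sigma> i = - 1"
  using abs_\<sigma>[of i] by linarith

lemma h_eq_iff: "i \<le> e \<Longrightarrow> j \<le> e \<Longrightarrow> h i = h j \<longleftrightarrow> i = j"
  using h by (auto simp: bij_betw_def inj_on_def)

lemma h_in: "i \<le> e \<Longrightarrow> h i \<in> pverts D"
  using h by (auto simp: bij_betw_def)

lemma inj_arc: "inj_on arc {..<e}"
proof (rule inj_onI)
  fix i j assume ij: "i \<in> {..<e}" "j \<in> {..<e}" and eq: "arc i = arc j"
  from eq have "(h i = h j \<and> h (Suc i) = h (Suc j)) \<or> (h i = h (Suc j) \<and> h (Suc i) = h j)"
    by (simp add: arc_def split: if_splits)
  then show "i = j" using ij by (simp add: h_eq_iff Suc_le_eq) linarith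
qed

lemma arc_mem_iff:
  assumes "S \<subseteq> {..<e}" "i < e"
  shows "(h i, h (Suc i)) \<in> arc ` S \<longleftrightarrow> i \<in> S \<and> \<sigma> i = 1"
    and "(h (Suc i), h i) \<in> arc ` S \<longleftrightarrow> i \<in> S \<and> \<sigma> i = - 1"
proof -
  have le: "j \<in> S \<Longrightarrow> j < e" for j using assms by auto
  show "(h i, h (Suc i)) \<in> arc ` S \<longleftrightarrow> i \<in> S \<and> \<sigma> i = 1"
    using assms(2) le by (auto simp: arc_def image_iff h_eq_iff Suc_le_eq split: if_splits)
  show "(h (Suc i), h i) \<in> arc ` S \<longleftrightarrow> i \<in> S \<and> \<sigma> i = - 1"
    using assms(2) le \<sigma>_cases[of i] by (auto simp: arc_def image_iff h_eq_iff Suc_le_eq split: if_splits)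
qed

lemma adj_sub:
  assumes "S \<subseteq> {..<e}" "i \<le> e" "j \<le> e"
  shows "(h i, h j) \<in> parcs (sub S) \<or> (h j, h i) \<in> parcs (sub S) \<longleftrightarrow>
    (j = Suc i \<and> i \<in> S) \<or> (i = Suc j \<and> j \<in> S)"
proof -
  have le: "l \<in> S \<Longrightarrow> l < e" for l using assms by auto
  show ?thesis
  proof
    assume "(h i, h j) \<in> parcs (sub S) \<or> (h j, h i) \<in> parcs (sub S)"
    then obtain l where "l \<in> S" "(h i = h l \<and> h j = h (Suc l)) \<or> (h j = h l \<and> h i = h (Suc l))"
      by (auto simp: sub_def arc_def split: if_splits)
    moreover from this le have "l < e" by auto
    ultimately show "(j = Suc i \<and> i \<in> S) \<or> (i = Suc j \<and> j \<in> S)"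
      using assms by (auto simp: h_eq_iff)
  next
    assume "(j = Suc i \<and> i \<in> S) \<or> (i = Suc j \<and> j \<in> S)"
    then show "(h i, h j) \<in> parcs (sub S) \<or> (h j, h i) \<in> parcs (sub S)"
      using arc_mem_iff[OF assms(1)] le \<sigma>_cases[of i] \<sigma>_cases[of j] by (auto simp: sub_def)
  qed
qed

lemma sub_inj: "inj_on sub (Pow {..<e})"
proof (rule inj_onI)
  fix S T assume "S \<in> Pow {..<e}" "T \<in> Pow {..<e}" "sub S = sub T"
  then show "S = T" using inj_on_image_eq_iff[OF inj_arc, of S T] by (auto simp: sub_def)
qed

lemma subgraph_sub:
  assumes "S \<subseteq> {..<e}"
  shows "subgraph (with_proj (sub S)) (with_proj D)" "no_isolated_vertices (sub S)"
proof -
  have le: "l \<in> S \<Longrightarrow> l < e" for l using assms by auto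
  have "wf_digraph (with_proj D)"
    by (unfold_locales) (auto simp: arcs_D arc_def h_in)
  moreover have "wf_digraph (with_proj (sub S))"
    by (unfold_locales) (auto simp: sub_def arc_def)
  ultimately show "subgraph (with_proj (sub S)) (with_proj D)"
    using assms le by (auto simp: subgraph_def arcs_D sub_def Suc_le_eq less_imp_le intro!: h_in)
  show "no_isolated_vertices (sub S)"
    unfolding no_isolated_vertices_def parcs_mk_symmetric_iff
  proof
    fix v assume "v \<in> pverts (sub S)"
    then obtain i where "i \<in> S" "v = h i \<or> v = h (Suc i)" by (auto simp: sub_def)
    moreover from this le have "i < e" by auto
    ultimately show "\<exists>u. (u, v) \<in> parcs (sub S) \<or> (v, u) \<in> parcs (sub S)"
      using adj_sub[OF assms, of i "Suc i"] by auto
  qed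
qed

lemma subgraph_eq_sub:
  assumes H: "subgraph (with_proj H) (with_proj D)" "no_isolated_vertices H"
  obtains S where "S \<subseteq> {..<e}" "H = sub S"
proof -
  define S where "S = {i. i < e \<and> arc i \<in> parcs H}"
  have "parcs H \<subseteq> arc ` {..<e}" and wf: "wf_digraph (with_proj H)"
    using H by (auto simp: subgraph_def arcs_D)
  then have parcs: "parcs H = arc ` S" by (auto simp: S_def)
  have "pverts H = fst ` parcs H \<union> snd ` parcs H"
  proof
    show "pverts H \<subseteq> fst ` parcs H \<union> snd ` parcs H"
    proof
      fix v assume "v \<in> pverts H"
      then obtain u where "(u, v) \<in> parcs H \<or> (v, u) \<in> parcs H"
        using H(2) by (auto simp: no_isolated_vertices_def parcs_mk_symmetric_iff)
      then show "v \<in> fst ` parcs H \<union> snd ` parcs H"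
        by (metis UnI1 UnI2 fst_conv image_eqI snd_conv)
    qed
    show "fst ` parcs H \<union> snd ` parcs H \<subseteq> pverts H"
      using wf_digraph.tail_in_verts[OF wf] wf_digraph.head_in_verts[OF wf] by (simp add: image_subset_iff)
  qed
  also have "\<dots> = (\<Union>i\<in>S. {fst (arc i), snd (arc i)})" unfolding parcs by blast
  also have "\<dots> = (\<Union>i\<in>S. {h i, h (Suc i)})" by (intro SUP_cong refl) (auto simp: arc_def)
  also have "\<dots> = h ` (S \<union> Suc ` S)" by blast
  finally have "H = sub S" using parcs by (cases H) (simp add: sub_def)
  moreover have "S \<subseteq> {..<e}" by (auto simp: S_def)
  ultimately show ?thesis using that by blast
qed

lemma copies_eq: "copies G D = sub ` {S \<in> Pow {..<e}. \<exists>f. underlying_iso f G (sub S)}"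
proof
  show "copies G D \<subseteq> sub ` {S \<in> Pow {..<e}. \<exists>f. underlying_iso f G (sub S)}"
  proof
    fix H assume H: "H \<in> copies G D"
    then have "subgraph (with_proj H) (with_proj D)" "no_isolated_vertices H" and ex: "\<exists>f. underlying_iso f G H"
      by (simp_all add: copies_def)
    then obtain S where "S \<subseteq> {..<e}" "H = sub S" using subgraph_eq_sub by blast
    then show "H \<in> sub ` {S \<in> Pow {..<e}. \<exists>f. underlying_iso f G (sub S)}"
      using ex by (intro image_eqI[of _ _ S]) simp_all
  qed
  show "sub ` {S \<in> Pow {..<e}. \<exists>f. underlying_iso f G (sub S)} \<subseteq> copies G D"
  proof (rule image_subsetI)
    fix S assume "S \<in> {S \<in> Pow {..<e}. \<exists>f. underlying_iso f G (sub S)}"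
    then show "sub S \<in> copies G D" using subgraph_sub[of S] by (simp add: copies_def)
  qed
qed

lemma coord_iso_imp_iso:
  assumes S: "S \<subseteq> {..<e}" and g: "coord_iso g G S"
  shows "underlying_iso (h \<circ> g) G (sub S)"
proof -
  have sub: "S \<union> Suc ` S \<subseteq> {..e}" using S by auto
  have "bij_betw h (S \<union> Suc ` S) (pverts (sub S))"
    using h inj_on_subset[OF _ sub] by (auto simp: bij_betw_def sub_def)
  moreover have gb: "bij_betw g (pverts G) (S \<union> Suc ` S)" using g by (simp add: coord_iso_def)
  ultimately have "bij_betw (h \<circ> g) (pverts G) (pverts (sub S))" by (rule bij_betw_trans[rotated])
  moreover have "g u \<le> e" if "u \<in> pverts G" for u
    using that gb sub by (auto simp: bij_betw_def)
  ultimately show ?thesis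
    using g by (simp add: underlying_iso_def parcs_mk_symmetric_iff adj_sub[OF S] coord_iso_def)
qed

lemma iso_imp_coord_iso:
  assumes S: "S \<subseteq> {..<e}" and f: "underlying_iso f G (sub S)"
  obtains g where "coord_iso g G S" "\<And>u. u \<in> pverts G \<Longrightarrow> f u = h (g u)"
proof -
  define g where "g u = inv_into {..e} h (f u)" for u
  have sub: "S \<union> Suc ` S \<subseteq> {..e}" using S by auto
  have inj: "inj_on h (S \<union> Suc ` S)" using h inj_on_subset[OF _ sub] by (auto simp: bij_betw_def)
  have fb: "bij_betw f (pverts G) (h ` (S \<union> Suc ` S))" using f by (simp add: underlying_iso_def sub_def)
  have inv: "inv_into {..e} h (h i) = i" if "i \<le> e" for i
    using that h by (auto simp: bij_betw_def intro: inv_into_f_f)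
  have gS: "g u \<in> S \<union> Suc ` S \<and> h (g u) = f u" if "u \<in> pverts G" for u
  proof -
    have "f u \<in> h ` (S \<union> Suc ` S)" using fb that by (auto simp: bij_betw_def)
    then obtain i where "i \<in> S \<union> Suc ` S" "f u = h i" by blast
    moreover from this have "i \<le> e" using sub by auto
    ultimately show ?thesis using inv by (simp add: g_def)
  qed
  have "bij_betw (inv_into {..e} h) (h ` (S \<union> Suc ` S)) (S \<union> Suc ` S)"
    by (rule bij_betw_byWitness[where f' = h]) (use sub inv in \<open>auto simp: subset_iff\<close>)
  then have "bij_betw g (pverts G) (S \<union> Suc ` S)"
    using bij_betw_trans[OF fb] by (simp add: g_def[abs_def] comp_def)
  moreover have "(u, v) \<in> parcs G \<or> (v, u) \<in> parcs G \<longleftrightarrow>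
        (g v = Suc (g u) \<and> g u \<in> S) \<or> (g u = Suc (g v) \<and> g v \<in> S)"
    if uv: "u \<in> pverts G" "v \<in> pverts G" for u v
  proof -
    have "(u, v) \<in> parcs G \<or> (v, u) \<in> parcs G \<longleftrightarrow> (f u, f v) \<in> parcs (sub S) \<or> (f v, f u) \<in> parcs (sub S)"
      using f uv by (simp add: underlying_iso_def parcs_mk_symmetric_iff)
    also have "\<dots> \<longleftrightarrow> (h (g u), h (g v)) \<in> parcs (sub S) \<or> (h (g v), h (g u)) \<in> parcs (sub S)"
      using gS uv by simp
    also have "\<dots> \<longleftrightarrow> (g v = Suc (g u) \<and> g u \<in> S) \<or> (g u = Suc (g v) \<and> g v \<in> S)"
      using gS uv sub by (intro adj_sub[OF S]) blast+
    finally show ?thesis .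
  qed
  ultimately have "coord_iso g G S" by (auto simp: coord_iso_def)
  then show ?thesis using that gS by auto
qed

text \<open>An arc of G that goes up the path over edge i is reversed when \<sigma> i = -1, one that
  goes down when \<sigma> i = 1. In both cases the factor is -1 exactly for reversed arcs.\<close>

lemma reversed_edges_sign:
  assumes S: "S \<subseteq> {..<e}" and g: "coord_iso g G S" and f: "\<And>u. u \<in> pverts G \<Longrightarrow> f u = h (g u)"
    and wf: "\<And>u v. (u, v) \<in> parcs G \<Longrightarrow> u \<in> pverts G \<and> v \<in> pverts G" and fin: "finite (parcs G)"
  shows "(- 1) ^ reversed_edges f G (sub S) =
    (\<Prod>(u, v)\<in>parcs G. if g v = Suc (g u) then \<sigma> (g u) else - \<sigma> (g v))"
proof -
  have "(f v, f u) \<in> parcs (sub S) \<longleftrightarrow> (if g v = Suc (g u) then \<sigma> (g u) else - \<sigma> (g v)) = - 1"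
    if uv: "(u, v) \<in> parcs G" for u v
  proof -
    have V: "u \<in> pverts G" "v \<in> pverts G" using wf uv by auto
    have "f u = h (g u)" "f v = h (g v)" using f V by auto
    moreover from coord_iso_step[OF g uv V]
    have "(h (g v), h (g u)) \<in> arc ` S \<longleftrightarrow> (if g v = Suc (g u) then \<sigma> (g u) else - \<sigma> (g v)) = - 1"
    proof
      assume *: "g v = Suc (g u) \<and> g u \<in> S"
      then have "g u < e" using S by auto
      then show ?thesis using * arc_mem_iff(2)[OF S] by simp
    next
      assume *: "g u = Suc (g v) \<and> g v \<in> S"
      then have "g v < e" using S by auto
      then show ?thesis using * arc_mem_iff(1)[OF S] by simp
    qed
    ultimately show ?thesis by (simp add: sub_def)
  qed
  then have "reversed_edges f G (sub S) =
      card {p \<in> parcs G. (case p of (u, v) \<Rightarrow> if g v = Suc (g u) then \<sigma> (g u) else - \<sigma> (g v)) = - 1}"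
    unfolding reversed_edges_def by (intro arg_cong[where f = card]) auto
  also have "(- 1 :: int) ^ \<dots> = (\<Prod>(u, v)\<in>parcs G. if g v = Suc (g u) then \<sigma> (g u) else - \<sigma> (g v))"
    by (rule minus_one_power_card[OF fin]) (auto simp: abs_\<sigma>)
  finally show ?thesis .
qed

section \<open>Copies of directed paths\<close>

lemma coord_iso_path:
  assumes "coord_iso g (directed_path (Suc j)) S"
  obtains (up) a where "S = {a..<a + j}" "\<And>i. i \<le> j \<Longrightarrow> g i = a + i"
  | (down) a where "S = {a..<a + j}" "\<And>i. i \<le> j \<Longrightarrow> g i = a + j - i"
proof -
  have inj: "inj_on g {..j}" using assms by (simp add: coord_iso_def bij_betw_def pverts_directed_path)
  have step: "g (Suc i) = Suc (g i) \<or> g i = Suc (g (Suc i))" if "i < j" for i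
    using coord_iso_step[OF assms, of i "Suc i"] that
    by (auto simp: parcs_directed_path_iff pverts_directed_path)
  have "S = (\<lambda>(u, v). min (g u) (g v)) ` parcs (directed_path (Suc j))"
    by (rule coord_iso_edges[OF assms]) (auto simp: parcs_directed_path_iff pverts_directed_path)
  then have S: "S = (\<lambda>u. min (g u) (g (Suc u))) ` {..<j}"
    by (simp add: parcs_directed_path image_image)
  from unit_steps_monotone[OF inj step] show ?thesis
  proof
    assume *: "\<forall>i\<le>j. g i = g 0 + i"
    then have gi: "g i = g 0 + i" if "i \<le> j" for i using that by blast
    have "S = (\<lambda>u. g 0 + u) ` {..<j}" unfolding S
    proof (intro image_cong refl)
      fix u assume "u \<in> {..<j}"
      then show "min (g u) (g (Suc u)) = g 0 + u" using gi[of u] gi[of "Suc u"] by simp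
    qed
    also have "\<dots> = {g 0..<g 0 + j}"
      using image_add_atLeastLessThan[of "g 0" 0 j] by (simp add: lessThan_atLeast0 add.commute)
    finally show ?thesis using gi by (rule up)
  next
    assume *: "\<forall>i\<le>j. g i + i = g 0"
    \<comment> \<open>In the descending case the last vertex of the directed path has the leftmost
      position, so a is again the left end of the interval.\<close>
    define a where "a = g j"
    have g0: "g 0 = a + j" using * by (simp add: a_def)
    have gi: "g i = a + j - i" if "i \<le> j" for i
    proof -
      have "g i + i = a + j" using * that g0 by simp
      then show ?thesis by linarith
    qed
    have "S = (\<lambda>u. a + (j - Suc u)) ` {..<j}" unfolding S
    proof (intro image_cong refl)
      fix u assume "u \<in> {..<j}"
      then show "min (g u) (g (Suc u)) = a + (j - Suc u)" using gi[of u] gi[of "Suc u"] by simp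
    qed
    also have "\<dots> = {a..<a + j}"
    proof
      show "{a..<a + j} \<subseteq> (\<lambda>u. a + (j - Suc u)) ` {..<j}"
      proof
        fix x assume "x \<in> {a..<a + j}"
        then show "x \<in> (\<lambda>u. a + (j - Suc u)) ` {..<j}"
          by (intro image_eqI[of _ _ "a + j - Suc x"]) auto
      qed
    qed auto
    finally show ?thesis using gi by (rule down)
  qed
qed

lemma coord_iso_interval:
  assumes "j \<ge> 1"
  shows "coord_iso (\<lambda>i. a + i) (directed_path (Suc j)) {a..<a + j}"
proof -
  have "x \<in> {a..<a + j} \<union> Suc ` {a..<a + j}" if "x \<in> {a..a + j}" for x
  proof (cases "x = a + j")
    case True
    \<comment> \<open>The position a + j is not the left end of any edge in the interval, only the
      right end of edge a + j - 1; this is where j has to be positive.\<close>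
    then show ?thesis using assms by (intro UnI2 image_eqI[of _ _ "x - 1"]) auto
  qed (use that in auto)
  then have "{a..a + j} \<subseteq> {a..<a + j} \<union> Suc ` {a..<a + j}" by blast
  then have "{a..<a + j} \<union> Suc ` {a..<a + j} = {a..a + j}" by (intro subset_antisym) auto
  moreover have "bij_betw (\<lambda>i. a + i) {..j} {a..a + j}"
    by (rule bij_betw_byWitness[where f' = "\<lambda>i. i - a"]) auto
  ultimately show ?thesis
    by (auto simp: coord_iso_def pverts_directed_path parcs_directed_path_iff)
qed

text \<open>Whatever isomorphism \<open>SOME\<close> picks, it runs through the interval upwards or
  downwards. Going down flips all 2k signs, an even number, so both directions give the same
  product.\<close>

lemma signed_count_path:
  assumes "k \<ge> 1"
  shows "signed_count (directed_path (2 * k + 1)) D = run_count \<sigma> e k"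
proof -
  let ?G = "directed_path (Suc (2 * k))"
  let ?I = "\<lambda>a. {a..<a + 2 * k}"
  let ?K = "{a. a + 2 * k \<le> e}"
  have wf: "(u, v) \<in> parcs ?G \<Longrightarrow> u \<in> pverts ?G \<and> v \<in> pverts ?G" for u v
    by (auto simp: parcs_directed_path_iff pverts_directed_path)
  have fin: "finite (parcs ?G)" by (simp add: parcs_directed_path)
  have copies: "copies ?G D = (sub \<circ> ?I) ` ?K"
  proof
    show "copies ?G D \<subseteq> (sub \<circ> ?I) ` ?K"
    proof
      fix H assume "H \<in> copies ?G D"
      then obtain S f where S: "S \<subseteq> {..<e}" "H = sub S" and f: "underlying_iso f ?G (sub S)"
        by (auto simp: copies_eq)
      obtain g where "coord_iso g ?G S" using iso_imp_coord_iso[OF S(1) f] by blast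
      then obtain a where "S = ?I a" by (rule coord_iso_path) auto
      moreover have "a + 2 * k - 1 \<in> ?I a" using assms by simp
      ultimately have "a + 2 * k - 1 < e" using S(1) by blast
      then have "a \<in> ?K" using assms by simp
      moreover have "H = (sub \<circ> ?I) a" using S(2) \<open>S = ?I a\<close> by simp
      ultimately show "H \<in> (sub \<circ> ?I) ` ?K" by blast
    qed
    show "(sub \<circ> ?I) ` ?K \<subseteq> copies ?G D"
    proof clarify
      fix a assume "a + 2 * k \<le> e"
      then have "?I a \<subseteq> {..<e}" by auto
      then show "(sub \<circ> ?I) a \<in> copies ?G D"
        using coord_iso_imp_iso[OF _ coord_iso_interval[of "2 * k" a]] assms
        unfolding copies_eq by force
    qed
  qed
  have inj: "inj_on (sub \<circ> ?I) ?K"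
  proof (rule comp_inj_on)
    show "inj_on ?I ?K" using assms by (auto simp: inj_on_def atLeastLessThan_eq_iff)
    show "inj_on sub (?I ` ?K)" by (rule inj_on_subset[OF sub_inj]) auto
  qed
  have "(- 1) ^ reversed_edges (SOME f. underlying_iso f ?G (sub (?I a))) ?G (sub (?I a)) = (\<Prod>i\<in>?I a. \<sigma> i)"
    if a: "a \<in> ?K" for a
  proof -
    define S where "S = ?I a"
    have S: "S \<subseteq> {..<e}" using a by (auto simp: S_def)
    define f where "f = (SOME f. underlying_iso f ?G (sub S))"
    have "coord_iso (\<lambda>i. a + i) ?G S" unfolding S_def using assms by (intro coord_iso_interval) simp
    then have "underlying_iso (h \<circ> (\<lambda>i. a + i)) ?G (sub S)" by (rule coord_iso_imp_iso[OF S])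
    then have "underlying_iso f ?G (sub S)" 
      unfolding f_def by (rule someI[where P = "\<lambda>f. underlying_iso f ?G (sub S)"])
    then obtain g where g: "coord_iso g ?G S" and fg: "\<And>u. u \<in> pverts ?G \<Longrightarrow> f u = h (g u)"
      using iso_imp_coord_iso[OF S] by blast
    have "(- 1) ^ reversed_edges f ?G (sub S) =
        (\<Prod>u<2 * k. if g (Suc u) = Suc (g u) then \<sigma> (g u) else - \<sigma> (g (Suc u)))"
      by (subst reversed_edges_sign[OF S g fg wf fin])
         (simp_all add: parcs_directed_path prod.reindex inj_on_def)
    also have "\<dots> = (\<Prod>i\<in>S. \<sigma> i)"
      using g
    proof (cases rule: coord_iso_path)
      case (up b)
      have "(\<Prod>u<2 * k. if g (Suc u) = Suc (g u) then \<sigma> (g u) else - \<sigma> (g (Suc u))) = (\<Prod>u<2 * k. \<sigma> (b + u))"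
        by (intro prod.cong refl) (simp add: up)
      also have "\<dots> = (\<Prod>i\<in>S. \<sigma> i)" unfolding up(1)
        by (rule prod.reindex_bij_witness[of _ "\<lambda>i. i - b" "\<lambda>u. b + u"]) auto
      finally show ?thesis .
    next
      case (down b)
      have "(\<Prod>u<2 * k. if g (Suc u) = Suc (g u) then \<sigma> (g u) else - \<sigma> (g (Suc u))) =
          (\<Prod>u<2 * k. (- 1) * \<sigma> (b + 2 * k - Suc u))"
        by (intro prod.cong refl) (auto simp: down)
      also have "\<dots> = (\<Prod>u<2 * k. \<sigma> (b + 2 * k - Suc u))"
        by (subst prod.distrib) (simp add: prod_constant)
      also have "\<dots> = (\<Prod>i\<in>S. \<sigma> i)" unfolding down(1)
        by (rule prod.reindex_bij_witness[of _ "\<lambda>i. b + 2 * k - Suc i" "\<lambda>u. b + 2 * k - Suc u"]) auto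
      finally show ?thesis .
    qed
    finally show ?thesis by (simp add: S_def f_def)
  qed
  then have "signed_count ?G D = (\<Sum>a\<in>?K. \<Prod>i\<in>?I a. \<sigma> i)"
    unfolding signed_count_def copies sum.reindex[OF inj] by (intro sum.cong refl) simp
  then show ?thesis by (simp add: run_count_def)
qed

end

section \<open>Copies of two disjoint paths on three vertices\<close>

lemma parcs_two_P3_iff:
  "(Inl i, Inl j) \<in> parcs two_P3 \<longleftrightarrow> j = Suc i \<and> i < 2"
  "(Inr i, Inr j) \<in> parcs two_P3 \<longleftrightarrow> j = Suc i \<and> i < 2"
  "(Inl i, Inr j) \<notin> parcs two_P3" "(Inr i, Inl j) \<notin> parcs two_P3"
proof -
  have "(i, j) \<in> parcs (directed_path 3) \<longleftrightarrow> j = Suc i \<and> i < 2" for i j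
    using parcs_directed_path_iff[of i j 2] by (simp add: numeral_3_eq_3 numeral_2_eq_2)
  then show "(Inl i, Inl j) \<in> parcs two_P3 \<longleftrightarrow> j = Suc i \<and> i < 2"
    "(Inr i, Inr j) \<in> parcs two_P3 \<longleftrightarrow> j = Suc i \<and> i < 2"
    "(Inl i, Inr j) \<notin> parcs two_P3" "(Inr i, Inl j) \<notin> parcs two_P3"
    by (simp_all add: two_P3_def disjoint_union_def)
qed

text \<open>Each component covers three consecutive positions, in either direction, and a descent
  flips two signs, which cancel. Injectivity keeps the two triples disjoint, so their left ends
  differ by at least 3. If the first component lies to the right, the names a and b are exchanged,
  which does not affect the product.\<close>

lemma coord_iso_two_P3:
  fixes \<sigma> :: "nat \<Rightarrow> int"
  assumes g: "coord_iso g two_P3 S"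
  obtains a b where "a + 3 \<le> b" "S = {a, Suc a, b, Suc b}"
    "(\<Prod>(u, v)\<in>parcs two_P3. if g v = Suc (g u) then \<sigma> (g u) else - \<sigma> (g v)) =
      \<sigma> a * \<sigma> (Suc a) * (\<sigma> b * \<sigma> (Suc b))"
proof -
  have inj: "inj_on g (pverts two_P3)" using g by (simp add: coord_iso_def bij_betw_def)
  \<comment> \<open>Both components are treated at once, c being the embedding of either one; a is
    the leftmost of its three positions.\<close>
  have ex: "\<exists>a. (g (c 0) = a \<and> g (c 1) = Suc a \<and> g (c 2) = Suc (Suc a)) \<or>
            (g (c 0) = Suc (Suc a) \<and> g (c 1) = Suc a \<and> g (c 2) = a)"
    if c: "c = Inl \<or> c = Inr" for c :: "nat \<Rightarrow> nat + nat"
  proof -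
    have sub: "c ` {..2} \<subseteq> pverts two_P3" using c by (auto simp: pverts_two_P3)
    have "inj_on c {..2}" using c by (auto simp: inj_on_def)
    then have inj2: "inj_on (\<lambda>i. g (c i)) {..2}"
      using comp_inj_on[of c "{..2}" g] inj_on_subset[OF inj sub] by (simp add: comp_def)
    have step: "g (c (Suc i)) = Suc (g (c i)) \<or> g (c i) = Suc (g (c (Suc i)))" if "i < 2" for i
    proof -
      have "(c i, c (Suc i)) \<in> parcs two_P3"
        using c that by (elim disjE) (simp_all add: parcs_two_P3_iff)
      moreover have "c i \<in> pverts two_P3" "c (Suc i) \<in> pverts two_P3" using sub that by auto
      ultimately show ?thesis using coord_iso_step[OF g] by blast
    qed
    from unit_steps_monotone[OF inj2 step] show ?thesis
    proof
      assume *: "\<forall>i\<le>2. g (c i) = g (c 0) + i"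
      have "g (c 1) = g (c 0) + 1" "g (c 2) = g (c 0) + 2"
        using *[rule_format, of 1] *[rule_format, of 2] by simp_all
      then show ?thesis by (intro exI[of _ "g (c 0)"]) simp
    next
      assume *: "\<forall>i\<le>2. g (c i) + i = g (c 0)"
      have "g (c 1) + 1 = g (c 0)" "g (c 2) + 2 = g (c 0)"
        using *[rule_format, of 1] *[rule_format, of 2] by simp_all
      then show ?thesis by (intro exI[of _ "g (c 2)"]) simp
    qed
  qed
  obtain a where A: "(g (Inl 0) = a \<and> g (Inl 1) = Suc a \<and> g (Inl 2) = Suc (Suc a)) \<or>
            (g (Inl 0) = Suc (Suc a) \<and> g (Inl 1) = Suc a \<and> g (Inl 2) = a)"
    using ex[of Inl] by blast
  obtain b where B: "(g (Inr 0) = b \<and> g (Inr 1) = Suc b \<and> g (Inr 2) = Suc (Suc b)) \<or>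
            (g (Inr 0) = Suc (Suc b) \<and> g (Inr 1) = Suc b \<and> g (Inr 2) = b)"
    using ex[of Inr] by blast
  have ne: "g (Inl i) \<noteq> g (Inr j)" if "i \<le> 2" "j \<le> 2" for i j
    using inj_onD[OF inj, of "Inl i" "Inr j"] that by (auto simp: pverts_two_P3)
  have far: "a + 3 \<le> b \<or> b + 3 \<le> a"
  proof -
    have "a \<noteq> b \<and> a \<noteq> Suc b \<and> a \<noteq> Suc (Suc b) \<and> Suc a \<noteq> b \<and> Suc (Suc a) \<noteq> b"
      using A B
      by (elim disjE conjE)
         (use ne[of 0 0] ne[of 0 1] ne[of 0 2] ne[of 1 0] ne[of 1 1] ne[of 1 2] ne[of 2 0] ne[of 2 1] ne[of 2 2] in simp_all)
    then show ?thesis by presburger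
  qed
  have "S = (\<lambda>(u, v). min (g u) (g v)) ` parcs two_P3"
    by (rule coord_iso_edges[OF g]) (auto simp: parcs_two_P3 pverts_two_P3)
  then have "S = {min (g (Inl 0)) (g (Inl 1)), min (g (Inl 1)) (g (Inl 2)),
                  min (g (Inr 0)) (g (Inr 1)), min (g (Inr 1)) (g (Inr 2))}"
    by (simp add: parcs_two_P3)
  also have "\<dots> = {min (g (Inl 0)) (g (Inl 1)), min (g (Inl 1)) (g (Inl 2))} \<union>
                  {min (g (Inr 0)) (g (Inr 1)), min (g (Inr 1)) (g (Inr 2))}" by blast
  also have "{min (g (Inl 0)) (g (Inl 1)), min (g (Inl 1)) (g (Inl 2))} = {a, Suc a}"
    using A by (elim disjE conjE) (simp_all add: insert_commute)
  also have "{min (g (Inr 0)) (g (Inr 1)), min (g (Inr 1)) (g (Inr 2))} = {b, Suc b}"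
    using B by (elim disjE conjE) (simp_all add: insert_commute)
  finally have S: "S = {a, Suc a} \<union> {b, Suc b}" .
  define w where "w u v = (if g v = Suc (g u) then \<sigma> (g u) else - \<sigma> (g v))" for u v
  have "(\<Prod>(u, v)\<in>parcs two_P3. w u v) =
      (w (Inl 0) (Inl 1) * w (Inl 1) (Inl 2)) * (w (Inr 0) (Inr 1) * w (Inr 1) (Inr 2))"
    by (simp add: parcs_two_P3)
  also have "w (Inl 0) (Inl 1) * w (Inl 1) (Inl 2) = \<sigma> a * \<sigma> (Suc a)"
    using A by (elim disjE conjE) (simp_all add: w_def)
  also have "w (Inr 0) (Inr 1) * w (Inr 1) (Inr 2) = \<sigma> b * \<sigma> (Suc b)"
    using B by (elim disjE conjE) (simp_all add: w_def)
  finally have P: "(\<Prod>(u, v)\<in>parcs two_P3. w u v) = \<sigma> a * \<sigma> (Suc a) * (\<sigma> b * \<sigma> (Suc b))" .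
  from far show ?thesis
  proof
    assume "a + 3 \<le> b"
    moreover have "S = {a, Suc a, b, Suc b}" unfolding S by blast
    ultimately show ?thesis using that P unfolding w_def by blast
  next
    assume "b + 3 \<le> a"
    moreover have "S = {b, Suc b, a, Suc a}" unfolding S by blast
    moreover have "\<sigma> a * \<sigma> (Suc a) * (\<sigma> b * \<sigma> (Suc b)) = \<sigma> b * \<sigma> (Suc b) * (\<sigma> a * \<sigma> (Suc a))"
      by (rule mult.commute)
    ultimately show ?thesis using that[of b a] P unfolding w_def by metis
  qed
qed

lemma coord_iso_pair:
  assumes "a + 3 \<le> b"
  shows "\<exists>g. coord_iso g two_P3 {a, Suc a, b, Suc b}"
proof -
  define g :: "nat + nat \<Rightarrow> nat" where "g = case_sum (\<lambda>i. a + i) (\<lambda>i. b + i)"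
  have gs: "g (Inl i) = a + i" "g (Inr i) = b + i" for i by (simp_all add: g_def)
  have two: "Inl i \<in> pverts two_P3 \<longleftrightarrow> i \<le> 2" "Inr i \<in> pverts two_P3 \<longleftrightarrow> i \<le> 2" for i
    by (auto simp: pverts_two_P3)
  have "inj_on g (pverts two_P3)"
  proof (rule inj_onI)
    fix u v assume "u \<in> pverts two_P3" "v \<in> pverts two_P3" "g u = g v"
    then show "u = v" using assms by (cases u; cases v) (simp_all add: gs two)
  qed
  moreover have "g ` pverts two_P3 = {a, Suc a, b, Suc b} \<union> Suc ` {a, Suc a, b, Suc b}"
  proof -
    have le2: "{..2 :: nat} = {0, 1, 2}" by auto
    have "g ` pverts two_P3 = {a + 0, a + 1, a + 2, b + 0, b + 1, b + 2}"
      unfolding pverts_two_P3 le2 image_Un image_insert image_empty gs by blast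
    also have "\<dots> = {a, Suc a, Suc (Suc a), b, Suc b, Suc (Suc b)}" by simp
    finally show ?thesis by blast
  qed
  ultimately have "bij_betw g (pverts two_P3) ({a, Suc a, b, Suc b} \<union> Suc ` {a, Suc a, b, Suc b})"
    by (simp add: bij_betw_def)
  moreover have "(u, v) \<in> parcs two_P3 \<or> (v, u) \<in> parcs two_P3 \<longleftrightarrow>
        (g v = Suc (g u) \<and> g u \<in> {a, Suc a, b, Suc b}) \<or> (g u = Suc (g v) \<and> g v \<in> {a, Suc a, b, Suc b})"
    if uv: "u \<in> pverts two_P3" "v \<in> pverts two_P3" for u v
  proof -
    \<comment> \<open>In particular edge a + 2 is not in the set. It is the edge that would join the
      two triples when b = a + 3.\<close>
    have mem: "a + i \<in> {a, Suc a, b, Suc b} \<longleftrightarrow> i < 2" "b + i \<in> {a, Suc a, b, Suc b} \<longleftrightarrow> i < 2"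
      if "i \<le> 2" for i
      using that assms by (auto simp: le_Suc_eq numeral_2_eq_2)
    show ?thesis
    proof (cases u; cases v)
      fix i j assume "u = Inl i" "v = Inl j"
      then show ?thesis using uv mem(1)[of i] mem(1)[of j] by (simp only: two gs parcs_two_P3_iff) auto
    next
      fix i j assume "u = Inl i" "v = Inr j"
      then show ?thesis using uv assms mem(1)[of i] mem(2)[of j] by (simp only: two gs parcs_two_P3_iff) auto
    next
      fix i j assume "u = Inr i" "v = Inl j"
      then show ?thesis using uv assms mem(2)[of i] mem(1)[of j] by (simp only: two gs parcs_two_P3_iff) auto
    next
      fix i j assume "u = Inr i" "v = Inr j"
      then show ?thesis using uv mem(2)[of i] mem(2)[of j] by (simp only: two gs parcs_two_P3_iff) auto
    qed
  qed
  ultimately show ?thesis unfolding coord_iso_def by blast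
qed

context path_coords
begin

lemma signed_count_two_P3: "signed_count two_P3 D = pair_count \<sigma> e"
proof -
  define J :: "nat \<times> nat \<Rightarrow> nat set" where "J = (\<lambda>(a, b). {a, Suc a, b, Suc b})"
  let ?K = "{(a, b). a + 3 \<le> b \<and> b + 2 \<le> e}"
  have wf: "(u, v) \<in> parcs two_P3 \<Longrightarrow> u \<in> pverts two_P3 \<and> v \<in> pverts two_P3" for u v
    by (auto simp: parcs_two_P3 pverts_two_P3)
  have fin: "finite (parcs two_P3)" by (simp add: parcs_two_P3)
  have sub_J: "J p \<subseteq> {..<e}" if "p \<in> ?K" for p using that by (auto simp: J_def)
  have ex: "\<exists>f. underlying_iso f two_P3 (sub (J p))" if K: "p \<in> ?K" for p
  proof -
    obtain a b where p: "p = (a, b)" "a + 3 \<le> b" using K by auto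
    then obtain g where "coord_iso g two_P3 (J p)" using coord_iso_pair[of a b] by (auto simp: J_def)
    from coord_iso_imp_iso[OF sub_J[OF K] this] show ?thesis by blast
  qed
  have copies: "copies two_P3 D = (sub \<circ> J) ` ?K"
  proof
    show "copies two_P3 D \<subseteq> (sub \<circ> J) ` ?K"
    proof
      fix H assume "H \<in> copies two_P3 D"
      then obtain S f where S: "S \<subseteq> {..<e}" "H = sub S" and f: "underlying_iso f two_P3 (sub S)"
        unfolding copies_eq by blast
      obtain g where "coord_iso g two_P3 S" using iso_imp_coord_iso[OF S(1) f] by blast
      then obtain a b where ab: "a + 3 \<le> b" "S = {a, Suc a, b, Suc b}" by (rule coord_iso_two_P3)
      then have "Suc b < e" using S(1) by blast
      then have "(a, b) \<in> ?K" using ab by simp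
      moreover have "H = (sub \<circ> J) (a, b)" using S(2) ab by (simp add: J_def)
      ultimately show "H \<in> (sub \<circ> J) ` ?K" by (rule rev_image_eqI)
    qed
    show "(sub \<circ> J) ` ?K \<subseteq> copies two_P3 D"
    proof (rule image_subsetI)
      fix p assume p: "p \<in> ?K"
      then show "(sub \<circ> J) p \<in> copies two_P3 D"
        unfolding copies_eq using ex[OF p] sub_J[OF p] by (intro image_eqI[of _ _ "J p"]) simp_all
    qed
  qed
  have inj: "inj_on (sub \<circ> J) ?K"
  proof (rule comp_inj_on)
    show "inj_on J ?K" unfolding J_def by (rule inj_on_subset[OF inj_on_pair_set]) auto
    show "inj_on sub (J ` ?K)" by (rule inj_on_subset[OF sub_inj]) (use sub_J in blast)
  qed
  have "(- 1) ^ reversed_edges (SOME f. underlying_iso f two_P3 (sub (J p))) two_P3 (sub (J p)) =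
      (case p of (a, b) \<Rightarrow> \<sigma> a * \<sigma> (Suc a) * (\<sigma> b * \<sigma> (Suc b)))"
    if p: "p \<in> ?K" for p
  proof -
    obtain a b where ab: "p = (a, b)" "a + 3 \<le> b" using p by auto
    define S where "S = J p"
    have S: "S \<subseteq> {..<e}" using sub_J[OF p] by (simp add: S_def)
    define f where "f = (SOME f. underlying_iso f two_P3 (sub S))"
    have "underlying_iso f two_P3 (sub S)"
      using ex[OF p] unfolding f_def S_def[symmetric]
      by (rule someI_ex[where P = "\<lambda>f. underlying_iso f two_P3 (sub S)"])
    then obtain g where g: "coord_iso g two_P3 S" and fg: "\<And>u. u \<in> pverts two_P3 \<Longrightarrow> f u = h (g u)"
      using iso_imp_coord_iso[OF S] by blast
    have rev: "(- 1) ^ reversed_edges f two_P3 (sub S) =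
        (\<Prod>(u, v)\<in>parcs two_P3. if g v = Suc (g u) then \<sigma> (g u) else - \<sigma> (g v))"
      by (rule reversed_edges_sign[OF S g fg wf fin])
    obtain a' b' where ab': "a' + 3 \<le> b'" "S = {a', Suc a', b', Suc b'}"
      and P: "(\<Prod>(u, v)\<in>parcs two_P3. if g v = Suc (g u) then \<sigma> (g u) else - \<sigma> (g v)) =
        \<sigma> a' * \<sigma> (Suc a') * (\<sigma> b' * \<sigma> (Suc b'))"
      using g by (rule coord_iso_two_P3)
    \<comment> \<open>The chosen isomorphism only yields some pair of left ends, but the edge set
      determines the pair.\<close>
    have "(a', b') = (a, b)"
      using ab ab' by (intro inj_onD[OF inj_on_pair_set]) (simp_all add: S_def J_def)
    then show ?thesis using rev P ab by (simp add: f_def S_def)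
  qed
  then have "signed_count two_P3 D = (\<Sum>(a, b)\<in>?K. \<sigma> a * \<sigma> (Suc a) * (\<sigma> b * \<sigma> (Suc b)))"
    unfolding signed_count_def copies sum.reindex[OF inj] by (intro sum.cong refl) simp
  then show ?thesis by (simp add: pair_count_def)
qed

end


section \<open>Densities of oriented paths\<close>

lemma oriented_path_coords:
  assumes "oriented_path D"
  shows "\<exists>h e \<sigma>. path_coords D h e \<sigma>"
proof -
  have fin: "pair_fin_digraph D" and asym: "asym (parcs D)"
    using assms by (auto simp: oriented_path_def)
  then interpret pair_fin_digraph D by simp
  obtain m f where "m \<ge> 1" and f0: "underlying_iso f (directed_path m) D"
    using assms by (auto simp: oriented_path_def)
  then obtain e where e: "m = Suc e" by (cases m) auto
  have bij: "bij_betw f {..e} (pverts D)"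
    and adj: "\<And>i j. i \<le> e \<Longrightarrow> j \<le> e \<Longrightarrow>
      (i, j) \<in> parcs (directed_path m) \<or> (j, i) \<in> parcs (directed_path m) \<longleftrightarrow>
      (f i, f j) \<in> parcs D \<or> (f j, f i) \<in> parcs D"
    using f0 by (simp_all add: underlying_iso_def parcs_mk_symmetric_iff e pverts_directed_path)
  have edge: "(f i, f (Suc i)) \<in> parcs D \<or> (f (Suc i), f i) \<in> parcs D" if "i < e" for i
    using adj[of i "Suc i"] that by (simp add: e parcs_directed_path_iff)
  define \<sigma> :: "nat \<Rightarrow> int" where "\<sigma> i = (if (f i, f (Suc i)) \<in> parcs D then 1 else - 1)" for i
  define a where "a i = (if \<sigma> i = 1 then (f i, f (Suc i)) else (f (Suc i), f i))" for i
  have "parcs D = a ` {..<e}"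
  proof
    show "a ` {..<e} \<subseteq> parcs D"
    proof (rule image_subsetI)
      fix i assume "i \<in> {..<e}"
      then show "a i \<in> parcs D" using edge[of i] by (auto simp: a_def \<sigma>_def)
    qed
    show "parcs D \<subseteq> a ` {..<e}"
    proof (rule subrelI)
      fix u v assume uv: "(u, v) \<in> parcs D"
      then have "u \<in> f ` {..e}" "v \<in> f ` {..e}"
        using in_arcsD1 in_arcsD2 bij by (auto simp: bij_betw_def)
      then obtain i j where ij: "i \<le> e" "u = f i" "j \<le> e" "v = f j" by auto
      \<comment> \<open>Asymmetry excludes the opposite arc, so an arc that points backwards along
        the path indeed has sign -1.\<close>
      have "(v, u) \<notin> parcs D" using uv asym by (auto dest: asymD)
      moreover have "(j = Suc i \<and> i < e) \<or> (i = Suc j \<and> j < e)"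
        using adj[of i j] ij uv by (simp add: e parcs_directed_path_iff)
      ultimately show "(u, v) \<in> a ` {..<e}"
      proof (elim disjE)
        assume "j = Suc i \<and> i < e"
        then show ?thesis using uv ij by (intro image_eqI[of _ _ i]) (simp_all add: a_def \<sigma>_def)
      next
        assume "i = Suc j \<and> j < e" "(v, u) \<notin> parcs D"
        then show ?thesis using uv ij by (intro image_eqI[of _ _ j]) (simp_all add: a_def \<sigma>_def)
      qed
    qed
  qed
  then have "parcs D = (\<lambda>i. if \<sigma> i = 1 then (f i, f (Suc i)) else (f (Suc i), f i)) ` {..<e}"
    unfolding a_def[abs_def] .
  then have "path_coords D f e \<sigma>" using bij by unfold_locales (simp_all add: \<sigma>_def)
  then show ?thesis by blast
qed

context path_coords
begin

lemma card_parcs_D: "card (parcs D) = e"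
  using card_image[OF inj_arc] by (simp add: arcs_D)

text \<open>Vertex maps of D are transported along \<open>h\<close> to maps of positions. A backward
  edge has weight A(y, x) = 1/2 - B(x, y), so directions survive only as signs.\<close>

lemma hom_density_coords:
  assumes A: "weighted_tournament n A" and n: "n > 0"
  shows "hom_density D A =
    (\<Sum>\<psi> \<in> {..<Suc e} \<rightarrow>\<^sub>E {..<n}. \<Prod>i<e. 1 / 2 + real_of_int (\<sigma> i) * skew_entry A (\<psi> i) (\<psi> (Suc i))) /
      real n ^ Suc e"
proof -
  have dim: "dim_row A = n" using A by (auto simp: weighted_tournament_def)
  have card: "card (pverts D) = Suc e" using bij_betw_same_card[OF h] by simp
  have inv: "inv_into {..e} h (h i) = i" if "i \<le> e" for i
    using that h by (auto simp: bij_betw_def intro: inv_into_f_f)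
  have inv2: "inv_into {..e} h v \<le> e \<and> h (inv_into {..e} h v) = v" if "v \<in> pverts D" for v
    using that h by (metis bij_betw_imp_surj_on f_inv_into_f inv_into_into atMost_iff)
  have "(\<Sum>\<phi> \<in> pverts D \<rightarrow>\<^sub>E {..<n}. \<Prod>(x, y) \<in> parcs D. A $$ (\<phi> x, \<phi> y)) =
    (\<Sum>\<psi> \<in> {..<Suc e} \<rightarrow>\<^sub>E {..<n}. \<Prod>i<e. 1 / 2 + real_of_int (\<sigma> i) * skew_entry A (\<psi> i) (\<psi> (Suc i)))"
  proof (rule sum.reindex_bij_witness[where i = "\<lambda>\<psi>. \<lambda>v\<in>pverts D. \<psi> (inv_into {..e} h v)"
        and j = "\<lambda>\<phi>. \<lambda>i\<in>{..<Suc e}. \<phi> (h i)"])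
    fix \<phi> assume \<phi>: "\<phi> \<in> pverts D \<rightarrow>\<^sub>E {..<n}"
    show "(\<lambda>v\<in>pverts D. (\<lambda>i\<in>{..<Suc e}. \<phi> (h i)) (inv_into {..e} h v)) = \<phi>"
    proof
      fix v
      show "(\<lambda>v\<in>pverts D. (\<lambda>i\<in>{..<Suc e}. \<phi> (h i)) (inv_into {..e} h v)) v = \<phi> v"
        using \<phi> inv2[of v] by (cases "v \<in> pverts D") (auto simp: PiE_def extensional_def)
    qed
    show "(\<lambda>i\<in>{..<Suc e}. \<phi> (h i)) \<in> {..<Suc e} \<rightarrow>\<^sub>E {..<n}"
    proof (rule restrict_PiE_iff[THEN iffD2], rule ballI)
      fix i assume "i \<in> {..<Suc e}"
      then show "\<phi> (h i) \<in> {..<n}" using \<phi> h_in[of i] by (intro PiE_mem[OF \<phi>]) simp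
    qed
    have mem: "\<phi> (h i) < n" if "i \<le> e" for i using PiE_mem[OF \<phi> h_in[OF that]] by simp
    have "(\<Prod>(x, y) \<in> parcs D. A $$ (\<phi> x, \<phi> y)) = (\<Prod>i<e. case arc i of (x, y) \<Rightarrow> A $$ (\<phi> x, \<phi> y))"
      unfolding arcs_D prod.reindex[OF inj_arc] by (simp add: comp_def)
    also have "\<dots> = (\<Prod>i<e. 1 / 2 + real_of_int (\<sigma> i) *
        skew_entry A ((\<lambda>i\<in>{..<Suc e}. \<phi> (h i)) i) ((\<lambda>i\<in>{..<Suc e}. \<phi> (h i)) (Suc i)))"
    proof (rule prod.cong[OF refl])
      fix i assume "i \<in> {..<e}"
      then have i: "i \<le> e" "Suc i \<le> e" by auto
      have sk: "skew_entry A (\<phi> (h i)) (\<phi> (h (Suc i))) = - skew_entry A (\<phi> (h (Suc i))) (\<phi> (h i))"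
        by (rule skew_kernel.skew[OF skew_kernel_tournament[OF A n]]) (use mem i in auto)
      have "A $$ (\<phi> (h i), \<phi> (h (Suc i))) = 1 / 2 + skew_entry A (\<phi> (h i)) (\<phi> (h (Suc i)))"
        using skew_entry[OF A mem[OF i(1)] mem[OF i(2)]] by simp
      moreover have "A $$ (\<phi> (h (Suc i)), \<phi> (h i)) = 1 / 2 - skew_entry A (\<phi> (h i)) (\<phi> (h (Suc i)))"
        using skew_entry[OF A mem[OF i(2)] mem[OF i(1)]] sk by simp
      ultimately show "(case arc i of (x, y) \<Rightarrow> A $$ (\<phi> x, \<phi> y)) = 1 / 2 + real_of_int (\<sigma> i) *
        skew_entry A ((\<lambda>i\<in>{..<Suc e}. \<phi> (h i)) i) ((\<lambda>i\<in>{..<Suc e}. \<phi> (h i)) (Suc i))"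
        using i \<sigma>_cases[of i] by (elim disjE) (simp_all add: arc_def)
    qed
    finally show "(\<Prod>i<e. 1 / 2 + real_of_int (\<sigma> i) *
        skew_entry A ((\<lambda>i\<in>{..<Suc e}. \<phi> (h i)) i) ((\<lambda>i\<in>{..<Suc e}. \<phi> (h i)) (Suc i))) =
      (\<Prod>(x, y) \<in> parcs D. A $$ (\<phi> x, \<phi> y))" ..
  next
    fix \<psi> assume \<psi>: "\<psi> \<in> {..<Suc e} \<rightarrow>\<^sub>E {..<n}"
    show "(\<lambda>i\<in>{..<Suc e}. (\<lambda>v\<in>pverts D. \<psi> (inv_into {..e} h v)) (h i)) = \<psi>"
    proof
      fix i
      show "(\<lambda>i\<in>{..<Suc e}. (\<lambda>v\<in>pverts D. \<psi> (inv_into {..e} h v)) (h i)) i = \<psi> i"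
        using \<psi> inv[of i] h_in[of i] by (cases "i \<le> e") (auto simp: PiE_def extensional_def)
    qed
    show "(\<lambda>v\<in>pverts D. \<psi> (inv_into {..e} h v)) \<in> pverts D \<rightarrow>\<^sub>E {..<n}"
    proof (rule restrict_PiE_iff[THEN iffD2], rule ballI)
      fix v assume "v \<in> pverts D"
      then show "\<psi> (inv_into {..e} h v) \<in> {..<n}" using inv2[of v] by (intro PiE_mem[OF \<psi>]) simp
    qed
  qed
  then show ?thesis by (simp add: hom_density_def dim card)
qed

lemma hom_density_bound:
  fixes x :: "nat \<Rightarrow> real"
  assumes A: "weighted_tournament n A" and n: "n > 0" and \<epsilon>: "0 < \<epsilon>" "\<epsilon> \<le> 1 / 2"
    and sr: "lambda_max (skew_part A) \<le> \<epsilon> * real n"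
  defines "x \<equiv> moment n (skew_entry A)"
  shows "\<bar>2 ^ e * hom_density D A
      - (1 + (\<Sum>k=1..e. 4 ^ k * (- 1) ^ k * run_count \<sigma> e k * x k) + 16 * pair_count \<sigma> e * x 1 ^ 2)\<bar>
      \<le> 4 ^ e * (2 * \<epsilon>)\<^sup>2 * x 1 ^ 2"
proof -
  interpret moments n "skew_entry A" x "(2 * \<epsilon>)\<^sup>2"
    unfolding x_def by (rule moments_tournament[OF A n \<epsilon> sr])
  show ?thesis
    unfolding hom_density_coords[OF A n]
      path_density_expand[OF n, of e "\<lambda>i. real_of_int (\<sigma> i)" "skew_entry A"]
    by (rule path_expansion_bound[OF abs_\<sigma>])
qed

lemma run_count_zero: "e < k \<Longrightarrow> run_count \<sigma> e k = 0"
  by (simp add: run_count_def)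

end

section \<open>The two leading terms of the density\<close>

definition lead_path :: "'a pair_pre_digraph \<Rightarrow> int" where
  "lead_path D = (if ell_exists D then 4 ^ ell D * (- 1) ^ ell D * signed_count (directed_path (2 * ell D + 1)) D else 0)"

text \<open>The value 0 in the absence of \<open>ell\<close> lets one estimate cover both
  cases.\<close>

definition path_moment :: "'a pair_pre_digraph \<Rightarrow> nat \<Rightarrow> real mat \<Rightarrow> real" where
  "path_moment D n A = (if ell_exists D then moment n (skew_entry A) (ell D) else 0)"

definition excess :: "'a pair_pre_digraph \<Rightarrow> real mat \<Rightarrow> real" where
  "excess D A = 2 ^ card (parcs D) * hom_density D A - 1"

lemma ell_props:
  assumes "ell_exists D"
  shows "ell D \<ge> 1" "signed_count (directed_path (2 * ell D + 1)) D \<noteq> 0"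
    "1 \<le> k \<Longrightarrow> k < ell D \<Longrightarrow> signed_count (directed_path (2 * k + 1)) D = 0"
proof -
  have ex: "\<exists>l. l \<ge> 1 \<and> signed_count (directed_path (2 * l + 1)) D \<noteq> 0"
    using assms by (simp add: ell_exists_def)
  from LeastI_ex[OF ex] show "ell D \<ge> 1" "signed_count (directed_path (2 * ell D + 1)) D \<noteq> 0"
    by (simp_all add: ell_def)
  show "signed_count (directed_path (2 * k + 1)) D = 0" if "1 \<le> k" "k < ell D"
    using not_less_Least[of k "\<lambda>l. l \<ge> 1 \<and> signed_count (directed_path (2 * l + 1)) D \<noteq> 0"] that
    by (simp add: ell_def)
qed

text \<open>Single runs of length 2k cancel in total for k < \<open>ell\<close>, since their signed
  counts vanish, and for k > \<open>ell\<close> the moment is at most \<eta> times the one at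
  \<open>ell\<close>. K is fixed before n, A and \<epsilon>, so it depends on D alone.\<close>

lemma excess_bound:
  assumes D: "oriented_path D"
  shows "\<exists>K\<ge>0. \<forall>n A \<epsilon>. 0 < n \<longrightarrow> weighted_tournament n A \<longrightarrow> 0 < \<epsilon> \<longrightarrow> \<epsilon> \<le> 1 / 2 \<longrightarrow>
      lambda_max (skew_part A) \<le> \<epsilon> * real n \<longrightarrow>
      0 \<le> path_moment D n A \<and>
      \<bar>excess D A - (lead_path D * path_moment D n A + 16 * signed_count two_P3 D * (moment n (skew_entry A) 1)\<^sup>2)\<bar>
        \<le> K * (2 * \<epsilon>)\<^sup>2 * (path_moment D n A + (moment n (skew_entry A) 1)\<^sup>2)"
proof -
  obtain h e \<sigma> where "path_coords D h e \<sigma>" using oriented_path_coords[OF D] by blast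
  then interpret path_coords D h e \<sigma> .
  define K :: real where "K = 4 ^ e + (\<Sum>k=1..e. 4 ^ k * \<bar>run_count \<sigma> e k\<bar>)"
  have K: "(\<Sum>k=1..e. 4 ^ k * \<bar>run_count \<sigma> e k\<bar>) \<le> K" "4 ^ e \<le> K" "0 \<le> K"
    by (simp_all add: K_def sum_nonneg add_nonneg_nonneg)
  have main: "0 \<le> path_moment D n A \<and>
      \<bar>excess D A - (lead_path D * path_moment D n A + 16 * signed_count two_P3 D * (moment n (skew_entry A) 1)\<^sup>2)\<bar>
        \<le> K * (2 * \<epsilon>)\<^sup>2 * (path_moment D n A + (moment n (skew_entry A) 1)\<^sup>2)"
    if n: "0 < n" and A: "weighted_tournament n A" and \<epsilon>: "0 < \<epsilon>" "\<epsilon> \<le> 1 / 2"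
      and sr: "lambda_max (skew_part A) \<le> \<epsilon> * real n" for n A \<epsilon>
  proof -
    define x where "x = moment n (skew_entry A)"
    define z where "z = path_moment D n A"
    define \<eta> where "\<eta> = (2 * \<epsilon>)\<^sup>2"
    interpret moments n "skew_entry A" x \<eta>
      unfolding x_def \<eta>_def by (rule moments_tournament[OF A n \<epsilon> sr])
    define T where "T k = 4 ^ k * (- 1) ^ k * run_count \<sigma> e k * x k" for k
    have z0: "0 \<le> z" using x_nonneg by (simp add: z_def path_moment_def x_def[symmetric])
    have tail: "\<bar>(\<Sum>k=1..e. T k) - lead_path D * z\<bar> \<le> K * \<eta> * z"
    proof (cases "ell_exists D")
      case False
      have "T k = 0" if "k \<in> {1..e}" for k
      proof -
        have "signed_count (directed_path (2 * k + 1)) D = 0" using False that by (auto simp: ell_exists_def)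
        then show ?thesis using signed_count_path[of k] that by (simp add: T_def)
      qed
      then show ?thesis using False by (simp add: z_def path_moment_def lead_path_def)
    next
      case True
      define l where "l = ell D"
      have l: "l \<ge> 1" "run_count \<sigma> e l \<noteq> 0"
        using ell_props[OF True] signed_count_path[of l] by (simp_all add: l_def)
      \<comment> \<open>A nonzero count means that the run fits into D, so the term for l does occur
        in the sum.\<close>
      then have "l \<le> e" using run_count_zero[of l] by (cases "l \<le> e") auto
      have z: "z = x l" using True by (simp add: z_def path_moment_def x_def l_def)
      have lead: "lead_path D * z = T l"
        using True l(1) signed_count_path[of l] by (simp add: lead_path_def l_def[symmetric] T_def z)
      have "(\<Sum>k=1..e. T k) = T l + (\<Sum>k\<in>{1..e} - {l}. T k)"
        using l(1) \<open>l \<le> e\<close> by (intro sum.remove) auto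
      then have "(\<Sum>k=1..e. T k) - lead_path D * z = (\<Sum>k\<in>{1..e} - {l}. T k)"
        unfolding lead by simp
      also have "\<bar>\<dots>\<bar> \<le> (\<Sum>k\<in>{1..e} - {l}. 4 ^ k * \<bar>run_count \<sigma> e k\<bar> * (\<eta> * z))"
      proof (intro order.trans[OF sum_abs] sum_mono)
        fix k assume k: "k \<in> {1..e} - {l}"
        show "\<bar>T k\<bar> \<le> 4 ^ k * \<bar>run_count \<sigma> e k\<bar> * (\<eta> * z)"
        proof (cases "k < l")
          case True
          then have "run_count \<sigma> e k = 0"
            using ell_props(3)[OF \<open>ell_exists D\<close>, of k] signed_count_path[of k] k by (simp add: l_def)
          then show ?thesis by (simp add: T_def)
        next
          case False
          then have "x k \<le> \<eta> * z" using k x_decr_strict[of l k] by (auto simp: z)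
          then show ?thesis
            by (simp add: T_def abs_mult power_abs x_nonneg mult_left_mono)
        qed
      qed
      also have "\<dots> \<le> (\<Sum>k=1..e. 4 ^ k * \<bar>run_count \<sigma> e k\<bar> * (\<eta> * z))"
        using \<eta> z0 by (intro sum_mono2) auto
      also have "\<dots> = (\<Sum>k=1..e. 4 ^ k * \<bar>run_count \<sigma> e k\<bar>) * (\<eta> * z)"
        by (simp only: sum_distrib_right of_int_sum)
      also have "\<dots> \<le> K * (\<eta> * z)" using K(1) \<eta> z0 by (intro mult_right_mono) auto
      finally show ?thesis by (simp add: mult.assoc)
    qed
    have B: "\<bar>2 ^ e * hom_density D A - (1 + (\<Sum>k=1..e. T k) + 16 * pair_count \<sigma> e * x 1 ^ 2)\<bar> \<le> 4 ^ e * \<eta> * x 1 ^ 2"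
      unfolding T_def x_def \<eta>_def by (rule hom_density_bound[OF A n \<epsilon> sr])
    have "4 ^ e * \<eta> * x 1 ^ 2 \<le> K * \<eta> * x 1 ^ 2"
      using K(2) \<eta> by (intro mult_right_mono) auto
    with B tail have "\<bar>2 ^ e * hom_density D A - 1 - (lead_path D * z + 16 * pair_count \<sigma> e * x 1 ^ 2)\<bar>
        \<le> K * \<eta> * z + K * \<eta> * x 1 ^ 2" by linarith
    then show ?thesis using z0
      by (simp add: excess_def card_parcs_D signed_count_two_P3 x_def z_def \<eta>_def distrib_left)
  qed
  then show ?thesis using K(3) by blast
qed

section \<open>Sign of the excess\<close>

lemma nonneg_perturbation:
  fixes t a b p q \<kappa> :: real
  assumes "\<bar>t - (a * p + b * q)\<bar> \<le> \<kappa> * (p + q)" "0 \<le> p" "0 \<le> q" "\<kappa> \<le> 1" "1 \<le> a \<or> p = 0 \<and> 0 \<le> \<kappa>" "1 \<le> b"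
  shows "0 \<le> t"
proof -
  \<comment> \<open>The error is absorbed by lowering both coefficients by \<kappa>. When there is
    no leading path term, p = 0 and the size of a does not matter.\<close>
  have "(b - \<kappa>) * q \<ge> 0" using assms by (intro mult_nonneg_nonneg) auto
  moreover have "(a - \<kappa>) * p \<ge> 0" using assms by (cases "p = 0") auto
  moreover have "a * p + b * q - \<kappa> * (p + q) \<le> t" using assms(1) by linarith
  ultimately show ?thesis by (simp add: algebra_simps)
qed

text \<open>The error and the b-term together are at most p/4 + (|b| + 1) q, hence at most 3p/4,
  which is less than |a| p.\<close>

lemma dominant_term_sign:
  fixes t a b p q \<kappa> :: real
  assumes t: "\<bar>t - (a * p + b * q)\<bar> \<le> \<kappa> * (p + q)" and p: "0 < p" and q: "0 \<le> q" "(\<bar>b\<bar> + 1) * q \<le> p / 2"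
    and \<kappa>: "\<kappa> \<le> 1 / 4" and a: "1 \<le> \<bar>a\<bar>"
  shows "0 < a * t"
proof -
  have "\<kappa> * (p + q) \<le> 1 / 4 * (p + q)" using \<kappa> p q by (intro mult_right_mono) auto
  with t have "\<bar>t - (a * p + b * q)\<bar> \<le> p / 4 + q / 4" by (simp add: field_simps)
  then have "\<bar>t - a * p\<bar> \<le> p / 4 + q / 4 + \<bar>b * q\<bar>" by linarith
  also have "\<bar>b * q\<bar> = \<bar>b\<bar> * q" using q by (simp add: abs_mult)
  also have "p / 4 + q / 4 + \<bar>b\<bar> * q \<le> p / 4 + (\<bar>b\<bar> + 1) * q" using q by (simp add: algebra_simps)
  also have "\<dots> < p" using q p by linarith
  finally have lt: "\<bar>t - a * p\<bar> < p" .
  show ?thesis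
  proof (cases "a \<ge> 0")
    case True
    then have "1 * p \<le> a * p" using a p by (intro mult_right_mono) auto
    then have "t > 0" using lt by linarith
    then show ?thesis using True a by auto
  next
    case False
    then have "a * p \<le> (- 1) * p" using a p by (intro mult_right_mono) auto
    then have "t < 0" using lt by linarith
    then show ?thesis using False by (simp add: mult_neg_neg)
  qed
qed

lemma small_epsilon:
  fixes K \<epsilon> :: real
  assumes "K \<ge> 0" "\<epsilon> > 0"
  obtains \<epsilon>' where "0 < \<epsilon>'" "\<epsilon>' \<le> \<epsilon>" "\<epsilon>' \<le> 1 / 2" "K * (2 * \<epsilon>')\<^sup>2 \<le> 1 / 4"
proof -
  \<comment> \<open>With this value both \<epsilon>' and K \<epsilon>' are at most 1/8, so 4 (K
    \<epsilon>') \<epsilon>' is at most 1/16.\<close>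
  define \<epsilon>' where "\<epsilon>' = min \<epsilon> (1 / (8 * (K + 1)))"
  have e: "0 < \<epsilon>'" "\<epsilon>' \<le> \<epsilon>" using assms by (auto simp: \<epsilon>'_def)
  have "\<epsilon>' \<le> 1 / (8 * (K + 1))" by (simp add: \<epsilon>'_def)
  then have le: "(K + 1) * \<epsilon>' \<le> 1 / 8" using assms by (simp add: field_simps)
  moreover have "0 \<le> K * \<epsilon>'" using assms e by simp
  ultimately have s: "\<epsilon>' \<le> 1 / 8" "K * \<epsilon>' \<le> 1 / 8" using e by (simp_all add: algebra_simps)
  have "(K * \<epsilon>') * \<epsilon>' \<le> 1 / 8 * (1 / 8)" using s e by (intro mult_mono) auto
  then have "K * (2 * \<epsilon>')\<^sup>2 \<le> 1 / 4" by (simp add: power2_eq_square mult.assoc mult.left_commute)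
  then show ?thesis using that e s by simp
qed

lemma LTS_iff_excess:
  "LTS D \<longleftrightarrow> (\<exists>\<epsilon>>0. \<forall>n\<ge>1. \<forall>A. weighted_tournament n A \<and> lambda_max (skew_part A) \<le> \<epsilon> * real n \<longrightarrow> 0 \<le> excess D A)"
proof -
  have "0 \<le> excess D A \<longleftrightarrow> 1 / 2 ^ card (parcs D) \<le> hom_density D A" for A
    by (simp add: excess_def field_simps)
  then show ?thesis unfolding LTS_def by simp
qed

lemma LTAS_iff_excess:
  "LTAS D \<longleftrightarrow> (\<exists>\<epsilon>>0. \<forall>n\<ge>1. \<forall>A. weighted_tournament n A \<and> lambda_max (skew_part A) \<le> \<epsilon> * real n \<longrightarrow> excess D A \<le> 0)"
proof -
  have "excess D A \<le> 0 \<longleftrightarrow> hom_density D A \<le> 1 / 2 ^ card (parcs D)" for A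
    by (simp add: excess_def field_simps)
  then show ?thesis unfolding LTAS_def by simp
qed

text \<open>One \<delta> serves both claims: \<tau> = 1 makes the pair term dominate, a tiny \<tau>
  the path term. The excess then takes the sign of the dominant coefficient.\<close>

lemma tournaments_of_both_signs:
  assumes D: "oriented_path D" and C3: "signed_count (directed_path 3) D = 0"
    and C5: "signed_count (directed_path 5) D = 0" and P: "signed_count two_P3 D \<noteq> 0"
    and ell: "ell_exists D" and \<epsilon>: "\<epsilon> > 0"
  shows "\<exists>A. weighted_tournament 4 A \<and> lambda_max (skew_part A) \<le> \<epsilon> * real 4 \<and> 0 < signed_count two_P3 D * excess D A"
    and "\<exists>A. weighted_tournament 4 A \<and> lambda_max (skew_part A) \<le> \<epsilon> * real 4 \<and> 0 < lead_path D * excess D A"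
proof -
  obtain K where "K \<ge> 0" and bound: "\<And>n A \<epsilon>. \<lbrakk>0 < n; weighted_tournament n A; 0 < \<epsilon>; \<epsilon> \<le> 1 / 2;
      lambda_max (skew_part A) \<le> \<epsilon> * real n\<rbrakk> \<Longrightarrow>
      \<bar>excess D A - (lead_path D * path_moment D n A + 16 * signed_count two_P3 D * (moment n (skew_entry A) 1)\<^sup>2)\<bar>
        \<le> K * (2 * \<epsilon>)\<^sup>2 * (path_moment D n A + (moment n (skew_entry A) 1)\<^sup>2)"
    using excess_bound[OF D] by blast
  obtain \<epsilon>' where e': "0 < \<epsilon>'" "\<epsilon>' \<le> \<epsilon>" "\<epsilon>' \<le> 1 / 2" "K * (2 * \<epsilon>')\<^sup>2 \<le> 1 / 4"
    using small_epsilon[OF \<open>K \<ge> 0\<close> \<epsilon>] by metis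
  define L :: real where "L = lead_path D"
  define Q :: real where "Q = 16 * signed_count two_P3 D"
  define l where "l = ell D"
  \<comment> \<open>For l = 2 both leading moments would be of order \<delta>^4 at \<tau> = 1, and
    neither would dominate.\<close>
  have "l \<noteq> 1" using ell_props(2)[OF ell] C3 by (auto simp: l_def)
  moreover have "l \<noteq> 2" using ell_props(2)[OF ell] C5 by (auto simp: l_def)
  ultimately have l3: "l \<ge> 3" using ell_props(1)[OF ell] by (simp add: l_def)
  have "lead_path D \<noteq> 0" using ell_props(2)[OF ell] ell by (simp add: lead_path_def)
  then have "1 \<le> \<bar>lead_path D\<bar>" by simp
  then have L1: "1 \<le> \<bar>L\<bar>" unfolding L_def by linarith
  have "1 \<le> \<bar>signed_count two_P3 D\<bar>" using P by simp
  then have Q1: "1 \<le> \<bar>Q\<bar>" unfolding Q_def by linarith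
  \<comment> \<open>The first bound turns the spectral estimate 16 \<delta> into 4 \<epsilon>'; the
    second one absorbs the coefficient L when the pair term is to dominate.\<close>
  define \<delta> where "\<delta> = min (\<epsilon>' / 4) (1 / (8 * (\<bar>L\<bar> + 1)))"
  have \<delta>: "0 < \<delta>" "\<delta> \<le> \<epsilon>' / 4" using e' by (auto simp: \<delta>_def)
  have "\<delta> \<le> 1 / (8 * (\<bar>L\<bar> + 1))" by (simp add: \<delta>_def)
  then have \<delta>L: "(\<bar>L\<bar> + 1) * \<delta> \<le> 1 / 8" by (simp add: field_simps)
  have \<delta>8: "\<delta> \<le> 1 / 8" using \<delta> e' by linarith
  have \<delta>2: "\<delta>\<^sup>2 \<le> 1 / 2" using \<delta> \<delta>8 mult_mono[of \<delta> "1/8" \<delta> "1/8"] by (simp add: power2_eq_square)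
  have ex: "\<exists>A. weighted_tournament 4 A \<and> lambda_max (skew_part A) \<le> \<epsilon> * real 4 \<and>
      \<bar>excess D A - (L * (\<tau>\<^sup>2 * \<delta>\<^sup>2 * (\<delta>\<^sup>2 * (1 + \<tau>\<^sup>2)) ^ (l - 1)) + Q * (\<tau>\<^sup>2 * \<delta>\<^sup>2)\<^sup>2)\<bar>
      \<le> K * (2 * \<epsilon>')\<^sup>2 * (\<tau>\<^sup>2 * \<delta>\<^sup>2 * (\<delta>\<^sup>2 * (1 + \<tau>\<^sup>2)) ^ (l - 1) + (\<tau>\<^sup>2 * \<delta>\<^sup>2)\<^sup>2)"
    if \<tau>: "0 < \<tau>" "\<tau> \<le> 1" for \<tau>
  proof -
    obtain A where A: "weighted_tournament 4 A" "lambda_max (skew_part A) \<le> 16 * \<delta>"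
      "\<And>k. moment 4 (skew_entry A) (Suc k) = \<tau>\<^sup>2 * \<delta>\<^sup>2 * (\<delta>\<^sup>2 * (1 + \<tau>\<^sup>2)) ^ k"
      using rank_two_tournament[OF \<tau> \<delta>(1) \<delta>8] by metis
    have lam: "lambda_max (skew_part A) \<le> \<epsilon>' * real 4" using A(2) \<delta>(2) by simp
    have "moment 4 (skew_entry A) 1 = \<tau>\<^sup>2 * \<delta>\<^sup>2" using A(3)[of 0] by simp
    moreover have "path_moment D 4 A = \<tau>\<^sup>2 * \<delta>\<^sup>2 * (\<delta>\<^sup>2 * (1 + \<tau>\<^sup>2)) ^ (l - 1)"
      using A(3)[of "l - 1"] l3 ell by (simp add: path_moment_def l_def[symmetric])
    moreover have "lambda_max (skew_part A) \<le> \<epsilon> * real 4" using lam e'(2) by simp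
    ultimately show ?thesis
      using bound[OF _ A(1) e'(1,3) lam] A(1) by (auto simp: L_def Q_def)
  qed
  define w z where "w \<tau> = (\<tau>\<^sup>2 * \<delta>\<^sup>2)\<^sup>2" and "z \<tau> = \<tau>\<^sup>2 * \<delta>\<^sup>2 * (\<delta>\<^sup>2 * (1 + \<tau>\<^sup>2)) ^ (l - 1)" for \<tau>
  have wz: "0 < w \<tau>" "0 < z \<tau>" if "0 < \<tau>" for \<tau>
    using that \<delta> by (auto simp: w_def z_def intro!: mult_pos_pos zero_less_power add_pos_pos)
  show "\<exists>A. weighted_tournament 4 A \<and> lambda_max (skew_part A) \<le> \<epsilon> * real 4 \<and> 0 < signed_count two_P3 D * excess D A"
  proof -
    obtain A where A: "weighted_tournament 4 A" "lambda_max (skew_part A) \<le> \<epsilon> * real 4"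
      "\<bar>excess D A - (L * z 1 + Q * w 1)\<bar> \<le> K * (2 * \<epsilon>')\<^sup>2 * (z 1 + w 1)"
      using ex[of 1] by (auto simp: w_def z_def)
    \<comment> \<open>Since l is at least 3, z(1) is at most 4 \<delta>^6, against w(1) =
      \<delta>^4.\<close>
    have "(\<delta>\<^sup>2 * 2) ^ (l - 1) \<le> (\<delta>\<^sup>2 * 2) ^ 2" using l3 \<delta>2 by (intro power_decreasing) auto
    then have "\<delta>\<^sup>2 * (\<delta>\<^sup>2 * 2) ^ (l - 1) \<le> \<delta>\<^sup>2 * (\<delta>\<^sup>2 * 2) ^ 2" by (rule mult_left_mono) simp
    moreover have "z 1 = \<delta>\<^sup>2 * (\<delta>\<^sup>2 * 2) ^ (l - 1)" by (simp add: z_def)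
    ultimately have "z 1 \<le> \<delta>\<^sup>2 * (\<delta>\<^sup>2 * 2) ^ 2" by simp
    also have "\<dots> = 4 * \<delta>\<^sup>2 * w 1" by (simp add: w_def power2_eq_square)
    finally have z1: "z 1 \<le> 4 * \<delta>\<^sup>2 * w 1" .
    have "(\<bar>L\<bar> + 1) * z 1 \<le> (\<bar>L\<bar> + 1) * (4 * \<delta>\<^sup>2 * w 1)" using z1 by (intro mult_left_mono) auto
    also have "\<dots> = ((\<bar>L\<bar> + 1) * \<delta>) * (4 * \<delta> * w 1)" by (simp add: power2_eq_square)
    also have "\<dots> \<le> 1 / 8 * (4 * \<delta> * w 1)" using \<delta>L \<delta> wz[of 1] by (intro mult_right_mono) auto
    also have "\<dots> \<le> w 1 / 2" using \<delta>8 \<delta> wz[of 1] by (simp add: mult_left_le_one_le)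
    finally have dom: "(\<bar>L\<bar> + 1) * z 1 \<le> w 1 / 2" .
    have "0 < Q * excess D A"
      by (rule dominant_term_sign[where p = "w 1" and q = "z 1" and b = L and \<kappa> = "K * (2 * \<epsilon>')\<^sup>2"])
         (use A(3) wz[of 1] dom e'(4) Q1 in \<open>simp_all add: add.commute\<close>)
    then have "0 < signed_count two_P3 D * excess D A" by (auto simp: Q_def zero_less_mult_iff)
    then show ?thesis using A by blast
  qed
  show "\<exists>A. weighted_tournament 4 A \<and> lambda_max (skew_part A) \<le> \<epsilon> * real 4 \<and> 0 < lead_path D * excess D A"
  proof -
    \<comment> \<open>Here w is at most \<tau>^4 and z at least \<tau>^2 \<delta>^(2l), so \<tau>
      has to be small against \<delta>^l; the factor 2 (|Q| + 1) is the margin that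
      \<open>dominant_term_sign\<close> asks for.\<close>
    define \<tau> where "\<tau> = \<delta> ^ l / (2 * (\<bar>Q\<bar> + 1))"
    have \<delta>l: "0 < \<delta> ^ l" "\<delta> ^ l \<le> 1" using \<delta> \<delta>8 by (auto intro: power_le_one)
    have \<tau>0: "0 < \<tau>" using \<delta>l by (simp add: \<tau>_def add_nonneg_pos)
    have Q\<tau>: "(\<bar>Q\<bar> + 1) * \<tau> = \<delta> ^ l / 2" by (simp add: \<tau>_def field_simps)
    have "1 * \<tau> \<le> (\<bar>Q\<bar> + 1) * \<tau>" using \<tau>0 by (intro mult_right_mono) auto
    then have \<tau>l: "\<tau> \<le> \<delta> ^ l" using Q\<tau> \<delta>l by linarith
    then have \<tau>1: "\<tau> \<le> 1" using \<delta>l by linarith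
    obtain A where A: "weighted_tournament 4 A" "lambda_max (skew_part A) \<le> \<epsilon> * real 4"
      "\<bar>excess D A - (L * z \<tau> + Q * w \<tau>)\<bar> \<le> K * (2 * \<epsilon>')\<^sup>2 * (z \<tau> + w \<tau>)"
      using ex[OF \<tau>0 \<tau>1] by (auto simp: w_def z_def)
    have "(\<delta>\<^sup>2) ^ (l - 1) \<le> (\<delta>\<^sup>2 * (1 + \<tau>\<^sup>2)) ^ (l - 1)"
      by (intro power_mono) (auto simp: algebra_simps)
    then have "\<tau>\<^sup>2 * (\<delta>\<^sup>2 * (\<delta>\<^sup>2) ^ (l - 1)) \<le> z \<tau>"
      unfolding z_def mult.assoc by (intro mult_left_mono) auto
    moreover have "\<delta>\<^sup>2 * (\<delta>\<^sup>2) ^ (l - 1) = (\<delta> ^ l)\<^sup>2"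
      using l3 by (cases l) (auto simp: power_mult[symmetric] mult.commute power2_eq_square power_mult_distrib)
    ultimately have z: "\<tau>\<^sup>2 * (\<delta> ^ l)\<^sup>2 \<le> z \<tau>" by simp
    have "w \<tau> = \<tau>\<^sup>2 * (\<tau>\<^sup>2 * (\<delta>\<^sup>2)\<^sup>2)" by (simp add: w_def power2_eq_square)
    also have "\<dots> \<le> \<tau>\<^sup>2 * (\<tau>\<^sup>2 * 1)" using \<delta> \<delta>8 by (intro mult_left_mono power_le_one) auto
    finally have "(\<bar>Q\<bar> + 1) * w \<tau> \<le> (\<bar>Q\<bar> + 1) * (\<tau>\<^sup>2 * \<tau>\<^sup>2)" by (intro mult_left_mono) auto
    also have "\<dots> = \<tau>\<^sup>2 * (((\<bar>Q\<bar> + 1) * \<tau>) * \<tau>)" by (simp add: power2_eq_square)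
    also have "\<dots> \<le> \<tau>\<^sup>2 * (\<delta> ^ l / 2 * \<delta> ^ l)"
      unfolding Q\<tau> using \<tau>l \<delta>l by (intro mult_left_mono) auto
    also have "\<dots> \<le> z \<tau> / 2" using z by (simp add: power2_eq_square)
    finally have dom: "(\<bar>Q\<bar> + 1) * w \<tau> \<le> z \<tau> / 2" .
    have "0 < L * excess D A"
      by (rule dominant_term_sign[where p = "z \<tau>" and q = "w \<tau>" and b = Q and \<kappa> = "K * (2 * \<epsilon>')\<^sup>2"])
         (use A(3) wz[OF \<tau>0] dom e'(4) L1 in simp_all)
    then show ?thesis using A by (auto simp: L_def)
  qed
qed

theorem theorem3p14:
  fixes D :: "'a pair_pre_digraph"
  assumes "oriented_path D"
    and "signed_count (directed_path 3) D = 0"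
    and "signed_count (directed_path 5) D = 0"
    and "signed_count two_P3 D \<noteq> 0"
  shows "(signed_count two_P3 D > 0 \<and>
            (\<not> ell_exists D \<or>
             (- 1) ^ ell D * signed_count (directed_path (2 * ell D + 1)) D > 0)
          \<longrightarrow> LTS D) \<and>
         (signed_count two_P3 D < 0 \<and>
            (\<not> ell_exists D \<or>
             (- 1) ^ ell D * signed_count (directed_path (2 * ell D + 1)) D < 0)
          \<longrightarrow> LTAS D) \<and>
         (ell_exists D \<and>
            signed_count two_P3 D * (- 1) ^ ell D *
              signed_count (directed_path (2 * ell D + 1)) D < 0
          \<longrightarrow> \<not> LTS D \<and> \<not> LTAS D)"
proof -
  let ?C = "(- 1) ^ ell D * signed_count (directed_path (2 * ell D + 1)) D"
  let ?P = "signed_count two_P3 D"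
  have lead: "lead_path D = 4 ^ ell D * ?C" if "ell_exists D" using that by (simp add: lead_path_def)
  obtain K where "K \<ge> 0" and bound: "\<And>n A \<epsilon>. \<lbrakk>0 < n; weighted_tournament n A; 0 < \<epsilon>; \<epsilon> \<le> 1 / 2;
      lambda_max (skew_part A) \<le> \<epsilon> * real n\<rbrakk> \<Longrightarrow>
      0 \<le> path_moment D n A \<and>
      \<bar>excess D A - (lead_path D * path_moment D n A + 16 * ?P * (moment n (skew_entry A) 1)\<^sup>2)\<bar>
        \<le> K * (2 * \<epsilon>)\<^sup>2 * (path_moment D n A + (moment n (skew_entry A) 1)\<^sup>2)"
    using excess_bound[OF assms(1)] by blast
  obtain \<epsilon> where \<epsilon>: "0 < \<epsilon>" "\<epsilon> \<le> 1 / 2" "K * (2 * \<epsilon>)\<^sup>2 \<le> 1 / 4"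
    using small_epsilon[OF \<open>K \<ge> 0\<close>, of 1] by auto
  have K0: "0 \<le> K * (2 * \<epsilon>)\<^sup>2" using \<open>K \<ge> 0\<close> by simp
  have no_ell: "path_moment D n A = 0" if "\<not> ell_exists D" for n A using that by (simp add: path_moment_def)
  \<comment> \<open>Both coefficients are positive integers, hence at least 1, which exceeds the
    error factor 1/4; without \<open>ell\<close> only the pair term remains.\<close>
  have "LTS D" if P: "?P > 0" and C: "\<not> ell_exists D \<or> ?C > 0"
    unfolding LTS_iff_excess
  proof (intro exI[of _ \<epsilon>] conjI allI impI)
    fix n A assume n: "1 \<le> n" and A: "weighted_tournament n A \<and> lambda_max (skew_part A) \<le> \<epsilon> * real n"
    have P1: "1 \<le> real_of_int (16 * ?P)" using P by linarith
    have "ell_exists D \<Longrightarrow> lead_path D > 0" using C lead by simp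
    then have L1: "ell_exists D \<Longrightarrow> 1 \<le> real_of_int (lead_path D)" by fastforce
    have b: "0 \<le> path_moment D n A \<and>
      \<bar>excess D A - (lead_path D * path_moment D n A + 16 * ?P * (moment n (skew_entry A) 1)\<^sup>2)\<bar>
        \<le> K * (2 * \<epsilon>)\<^sup>2 * (path_moment D n A + (moment n (skew_entry A) 1)\<^sup>2)"
      using n A \<epsilon> by (intro bound) auto
    show "0 \<le> excess D A"
      by (rule nonneg_perturbation[where a = "lead_path D" and b = "16 * ?P" and p = "path_moment D n A"
            and q = "(moment n (skew_entry A) 1)\<^sup>2" and \<kappa> = "K * (2 * \<epsilon>)\<^sup>2"])
         (use b P1 L1 no_ell[of n A] \<epsilon>(3) K0 in \<open>auto\<close>)
  qed (use \<epsilon> in auto)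
  moreover have "LTAS D" if P: "?P < 0" and C: "\<not> ell_exists D \<or> ?C < 0"
    unfolding LTAS_iff_excess
  proof (intro exI[of _ \<epsilon>] conjI allI impI)
    fix n A assume n: "1 \<le> n" and A: "weighted_tournament n A \<and> lambda_max (skew_part A) \<le> \<epsilon> * real n"
    have P1: "1 \<le> - real_of_int (16 * ?P)" using P by linarith
    have "ell_exists D \<Longrightarrow> lead_path D < 0" using C lead by (simp add: mult_less_0_iff)
    then have L1: "ell_exists D \<Longrightarrow> 1 \<le> - real_of_int (lead_path D)" by fastforce
    have b: "0 \<le> path_moment D n A \<and>
      \<bar>excess D A - (lead_path D * path_moment D n A + 16 * ?P * (moment n (skew_entry A) 1)\<^sup>2)\<bar>
        \<le> K * (2 * \<epsilon>)\<^sup>2 * (path_moment D n A + (moment n (skew_entry A) 1)\<^sup>2)"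
      using n A \<epsilon> by (intro bound) auto
    \<comment> \<open>The negated excess obeys the same estimate with negated coefficients, so this
      case reduces to the previous argument.\<close>
    have "- excess D A - (- lead_path D * path_moment D n A + - (16 * ?P) * (moment n (skew_entry A) 1)\<^sup>2) =
        - (excess D A - (lead_path D * path_moment D n A + 16 * ?P * (moment n (skew_entry A) 1)\<^sup>2))"
      by simp
    then have b': "\<bar>- excess D A - (- lead_path D * path_moment D n A + - (16 * ?P) * (moment n (skew_entry A) 1)\<^sup>2)\<bar>
        \<le> K * (2 * \<epsilon>)\<^sup>2 * (path_moment D n A + (moment n (skew_entry A) 1)\<^sup>2)"
      using b by (simp only: abs_minus_cancel)
    have "0 \<le> - excess D A"
      by (rule nonneg_perturbation[where a = "- lead_path D" and b = "- (16 * ?P)" and p = "path_moment D n A"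
            and q = "(moment n (skew_entry A) 1)\<^sup>2" and \<kappa> = "K * (2 * \<epsilon>)\<^sup>2"])
         (use b b' P1 L1 no_ell[of n A] \<epsilon>(3) K0 in \<open>auto\<close>)
    then show "excess D A \<le> 0" by simp
  qed (use \<epsilon> in auto)
  moreover have "\<not> LTS D \<and> \<not> LTAS D" if ell: "ell_exists D" and opp: "?P * ?C < 0"
  proof -
    have opp: "?P < 0 \<and> lead_path D > 0 \<or> ?P > 0 \<and> lead_path D < 0"
      using opp lead[OF ell] by (auto simp: mult_less_0_iff zero_less_mult_iff)
    \<comment> \<open>The coefficients have opposite signs, so within every tolerance the two
      four-vertex tournaments have excesses of opposite signs.\<close>
    have "\<exists>A. weighted_tournament 4 A \<and> lambda_max (skew_part A) \<le> \<epsilon> * real 4 \<and> excess D A < 0"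
      and "\<exists>A. weighted_tournament 4 A \<and> lambda_max (skew_part A) \<le> \<epsilon> * real 4 \<and> excess D A > 0"
      if "\<epsilon> > 0" for \<epsilon>
      using opp tournaments_of_both_signs[OF assms ell that]
      by (auto simp: zero_less_mult_iff)
    then show ?thesis
      unfolding LTS_iff_excess LTAS_iff_excess
      by (metis not_less one_le_numeral of_nat_numeral)
  qed
  ultimately show ?thesis by (simp add: mult.assoc)
qed

end
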